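(* Let $n\ge 2$ be an integer and let $s(n)=\left\lfloor \frac{(n-1)^2}{4}\right\rfloor+1$. Then the following hold. 1. A uniquely traceable graph of order $n$ has at most $s(n)$ edges. 2. For every integer $m$ such that $n-1\le m\le s(n)$ there exists a uniquely traceable graph of order $n$ and size $m$. 3. Up to isomorphism, there exist exactly $\max\left\{1,\,2^{\lceil \frac{n-1}{2}\rceil-3}\right\}$ uniquely traceable graphs of order $n$ and size $s(n)$.
   Context: Graphs are finite and simple. A graph is uniquely traceable if it contains exactly one hamiltonian path, where paths are regarded as (undirected) subgraphs. The order of a graph is its number of vertices and its size is its number of edges. *)

theory Defs
  imports Complex_Main
begin

text \<open>
  A graph is a pair of a vertex set and a set of edges, where an edge is the set of its two
  endpoints.
\<close>

type_synonym 'a ugraph = "'a set \<times> 'a set set"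

abbreviation verts :: "'a ugraph \<Rightarrow> 'a set" where
  "verts G \<equiv> fst G"

abbreviation edges :: "'a ugraph \<Rightarrow> 'a set set" where
  "edges G \<equiv> snd G"

definition simple_graph :: "'a ugraph \<Rightarrow> bool" where
  "simple_graph G \<longleftrightarrow> finite (verts G) \<and> (\<forall>e\<in>edges G. e \<subseteq> verts G \<and> card e = 2)"

definition graph_order :: "'a ugraph \<Rightarrow> nat" where
  "graph_order G = card (verts G)"

definition graph_size :: "'a ugraph \<Rightarrow> nat" where
  "graph_size G = card (edges G)"

definition subgraph :: "'a ugraph \<Rightarrow> 'a ugraph \<Rightarrow> bool" where
  "subgraph H G \<longleftrightarrow> verts H \<subseteq> verts G \<and> edges H \<subseteq> edges G"

text \<open>
  Paths are graphs rather than vertex sequences, so that a sequence and its reversal yield the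
  same path.
\<close>

definition path_of :: "'a list \<Rightarrow> 'a ugraph" where
  "path_of xs = (set xs, {{xs ! i, xs ! Suc i} | i. Suc i < length xs})"

definition is_path :: "'a ugraph \<Rightarrow> bool" where
  "is_path P \<longleftrightarrow> (\<exists>xs. xs \<noteq> [] \<and> distinct xs \<and> P = path_of xs)"

definition hamiltonian_path :: "'a ugraph \<Rightarrow> 'a ugraph \<Rightarrow> bool" where
  "hamiltonian_path G P \<longleftrightarrow> is_path P \<and> subgraph P G \<and> verts P = verts G"

definition uniquely_traceable :: "'a ugraph \<Rightarrow> bool" where
  "uniquely_traceable G \<longleftrightarrow> simple_graph G \<and> (\<exists>!P. hamiltonian_path G P)"

definition graph_iso :: "'a ugraph \<Rightarrow> 'b ugraph \<Rightarrow> bool" where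
  "graph_iso G H \<longleftrightarrow> (\<exists>f. bij_betw f (verts G) (verts H) \<and> (\<lambda>e. f ` e) ` edges G = edges H)"

definition s :: "nat \<Rightarrow> nat" where
  "s n = (n - 1)\<^sup>2 div 4 + 1"

end

theory Submission
  imports Defs
begin

text \<open>
  Number the vertices of a uniquely traceable graph \<open>0, \<dots>, n - 1\<close> along its hamiltonian path. The
  remaining edges (chords) are restricted by the fact that certain combinations of them would allow the
  path to be rerouted. An edge from \<open>0\<close> to \<open>j > 1\<close> is impossible, and symmetrically at the other end,
  so both ends are pendant (\<open>first_neighbour\<close>, \<open>last_neighbour\<close>); and if there is a chord from \<open>i\<close> to
  \<open>j\<close>, there is none from \<open>i + 1\<close> to \<open>j + 1\<close> (\<open>no_parallel_chords\<close>). Hence the left ends of the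
  chords of a fixed length \<open>d\<close> are pairwise nonconsecutive numbers between \<open>1\<close> and \<open>n - 2 - d\<close>, and
  there are at most half as many, rounded up. Summing over \<open>d\<close> gives exactly \<open>s n\<close>
  (\<open>nat_ut_card_le\<close>).

  In a graph attaining the bound, the number of chords of every length is maximal, which nearly
  determines their position: among the possible left ends \<open>2p + 1\<close> and \<open>2p + 2\<close> exactly one occurs
  (\<open>extremal_chord_pairs\<close>). Two further reroutings show that vertex \<open>1\<close> is adjacent to all vertices except
  \<open>n - 1\<close>, or vertex \<open>n - 2\<close> is adjacent to all vertices except \<open>0\<close> (\<open>extremal_fan_either_side\<close>). In
  the first case, deleting the vertices \<open>0\<close> and \<open>1\<close> leaves an extremal graph of order \<open>n - 2\<close>, and this
  step can be reversed (\<open>nat_ut_prolong\<close>, \<open>prolong_cover\<close>). So every extremal graph arises from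
  the path on two or three vertices by repeatedly prolonging it at one of its two ends. From order
  six on, the two ends give different results, so the number of numbered extremal graphs doubles
  whenever the order grows by two (\<open>card_extremal_set\<close>).

  An isomorphism of numbered uniquely traceable graphs is the identity or the reversal of the numbering
  (\<open>graph_iso_nat_ut\<close>). The last prolongation was at the start or at the end, and reversal exchanges
  these cases. Thus the isomorphism classes are represented by the graphs whose last prolongation
  was at the start; there are as many of them as numbered extremal graphs of order \<open>n - 2\<close>.
\<close>

section \<open>Hamiltonian paths as vertex sequences\<close>

definition adj :: "'a set set \<Rightarrow> 'a \<Rightarrow> 'a \<Rightarrow> bool" where
  "adj E a b \<longleftrightarrow> {a, b} \<in> E"

lemma adj_commute: "adj E a b \<longleftrightarrow> adj E b a"
  by (simp add: adj_def insert_commute)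

lemma successively_adj_rev: "successively (adj E) (rev ys) \<longleftrightarrow> successively (adj E) ys"
  by (simp add: adj_commute)

definition spans :: "'a set set \<Rightarrow> 'a set \<Rightarrow> 'a list \<Rightarrow> bool" where
  "spans E V ys \<longleftrightarrow> distinct ys \<and> set ys = V \<and> successively (adj E) ys"

lemma spans_rev: "spans E V (rev ys) \<longleftrightarrow> spans E V ys"
  by (simp add: spans_def successively_adj_rev del: successively_rev)

lemma edges_path_of_Nil: "edges (path_of []) = {}"
  by (simp add: path_of_def)

lemma edges_path_of_single: "edges (path_of [x]) = {}"
  by (simp add: path_of_def)

lemma edges_path_of_Cons:
  "edges (path_of (x # y # zs)) = insert {x, y} (edges (path_of (y # zs)))" (is "?L = ?R")
proof
  show "?L \<subseteq> ?R"
  proof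
    fix e assume "e \<in> ?L"
    then obtain i where i: "Suc i < length (x # y # zs)"
      "e = {(x # y # zs) ! i, (x # y # zs) ! Suc i}"
      by (auto simp: path_of_def)
    show "e \<in> ?R"
    proof (cases i)
      case 0
      then show ?thesis using i by simp
    next
      case (Suc j)
      then show ?thesis using i by (auto simp: path_of_def)
    qed
  qed
  show "?R \<subseteq> ?L"
  proof
    fix e assume "e \<in> ?R"
    then consider "e = {x, y}"
      | j where "Suc j < length (y # zs)" "e = {(y # zs) ! j, (y # zs) ! Suc j}"
      by (auto simp: path_of_def)
    then show "e \<in> ?L"
    proof cases
      case 1
      then have "Suc 0 < length (x # y # zs) \<and> e = {(x # y # zs) ! 0, (x # y # zs) ! Suc 0}"
        by simp
      then show ?thesis unfolding path_of_def snd_conv by blast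
    next
      case 2
      then have "Suc (Suc j) < length (x # y # zs)
          \<and> e = {(x # y # zs) ! Suc j, (x # y # zs) ! Suc (Suc j)}"
        by simp
      then show ?thesis unfolding path_of_def snd_conv by blast
    qed
  qed
qed

lemmas edges_path_of = edges_path_of_Nil edges_path_of_single edges_path_of_Cons

lemma edges_path_of_subset: "e \<in> edges (path_of xs) \<Longrightarrow> e \<subseteq> set xs"
  by (auto simp: path_of_def)

lemma edges_path_of_rev: "edges (path_of (rev xs)) = edges (path_of xs)"
proof -
  have sub: "edges (path_of (rev xs)) \<subseteq> edges (path_of xs)" for xs :: "'a list"
  proof
    fix e assume "e \<in> edges (path_of (rev xs))"
    then obtain i where i: "Suc i < length xs" "e = {rev xs ! i, rev xs ! Suc i}"
      by (auto simp: path_of_def)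
    \<comment> \<open>The edge at position \<open>i\<close> of the reversed list, counted from the other end.\<close>
    define j where "j = length xs - Suc (Suc i)"
    have "Suc j < length xs" "e = {xs ! j, xs ! Suc j}"
      using i by (auto simp: j_def rev_nth Suc_diff_Suc insert_commute)
    then show "e \<in> edges (path_of xs)"
      by (auto simp: path_of_def)
  qed
  show ?thesis
    using sub[of xs] sub[of "rev xs"] by simp
qed

lemma path_of_rev: "path_of (rev xs) = path_of xs"
  using edges_path_of_rev[of xs] by (simp add: path_of_def)

lemma successively_adj_iff: "successively (adj E) xs \<longleftrightarrow> edges (path_of xs) \<subseteq> E"
  by (auto simp: successively_conv_nth adj_def path_of_def)

lemma hamiltonian_path_iff:
  "hamiltonian_path G P \<longleftrightarrow> (\<exists>xs. xs \<noteq> [] \<and> spans (edges G) (verts G) xs \<and> P = path_of xs)"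
proof -
  have v: "verts (path_of xs) = set xs" for xs :: "'a list"
    by (simp add: path_of_def)
  have "subgraph (path_of xs) G \<and> verts (path_of xs) = verts G \<longleftrightarrow>
      set xs = verts G \<and> successively (adj (edges G)) xs" for xs
    unfolding subgraph_def v successively_adj_iff by blast
  then show ?thesis
    unfolding hamiltonian_path_def is_path_def spans_def by metis
qed

text \<open>
  The two vertices of degree one of a path are its ends, and from an end the path can be read off
  edge by edge; this is the only ambiguity in passing from a path to a vertex sequence.
\<close>

lemma path_of_inject_hd:
  assumes "distinct (x # xs)" "distinct (x # ys)"
    and "set xs = set ys" "edges (path_of (x # xs)) = edges (path_of (x # ys))"
  shows "xs = ys"
  using assms
proof (induction xs arbitrary: x ys)
  case Nil
  then show ?case by simp
next
  case (Cons y xs)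
  obtain z zs where ys: "ys = z # zs"
    using Cons.prems(3) by (cases ys) auto
  have x: "x \<notin> set (y # xs)" "x \<notin> set (z # zs)"
    using Cons.prems ys by auto
  have nx: "e \<in> edges (path_of (y # xs)) \<Longrightarrow> x \<notin> e" "e \<in> edges (path_of (z # zs)) \<Longrightarrow> x \<notin> e" for e
    using edges_path_of_subset[of e] x by blast+
  have eq: "insert {x, y} (edges (path_of (y # xs))) = insert {x, z} (edges (path_of (z # zs)))"
    using Cons.prems(4) by (simp add: ys edges_path_of)
  have "{x, y} \<in> insert {x, z} (edges (path_of (z # zs)))"
    using eq by blast
  with nx(2)[of "{x, y}"] have "{x, y} = {x, z}"
    by auto
  then have yz: "z = y"
    using x by (auto simp: doubleton_eq_iff)
  have "edges (path_of (y # xs)) = edges (path_of (y # zs))"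
    using eq nx unfolding yz by blast
  moreover have "set xs = set zs"
    using Cons.prems(1,2,3) insert_ident[of y "set xs" "set zs"] by (simp add: ys yz)
  ultimately have "xs = zs"
    using Cons.IH[of y zs] Cons.prems(1,2) ys yz by auto
  then show ?case
    using ys yz by simp
qed

lemma path_end_neighbour_unique:
  assumes "distinct ys" "{hd ys, a} \<in> edges (path_of ys)" "{hd ys, b} \<in> edges (path_of ys)"
  shows "a = b"
proof (cases ys rule: remdups_adj.cases)
  case (3 x y zs)
  have nx: "e \<in> edges (path_of (y # zs)) \<Longrightarrow> x \<notin> e" for e
    using edges_path_of_subset[of e "y # zs"] assms(1) 3 by auto
  have "c = y" if "{hd ys, c} \<in> edges (path_of ys)" for c
    using that nx[of "{x, c}"] assms(1) 3 by (auto simp: edges_path_of doubleton_eq_iff)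
  with assms show ?thesis by blast
qed (use assms in \<open>auto simp: edges_path_of\<close>)

lemma path_of_inject:
  assumes "distinct xs" "distinct ys" "path_of xs = path_of ys"
  shows "ys = xs \<or> ys = rev xs"
proof (cases "xs = []")
  case True
  then show ?thesis using assms(3) by (simp add: path_of_def)
next
  case False
  have sets: "set xs = set ys" and es: "edges (path_of xs) = edges (path_of ys)"
    using assms(3) by (simp_all add: path_of_def)
  have ne: "ys \<noteq> []"
    using False sets by auto
  have same: "ys = us" if "distinct us" "set us = set ys" "edges (path_of us) = edges (path_of ys)"
    "hd us = hd ys" "us \<noteq> []" for us
  proof -
    have u: "us = hd ys # tl us" and y: "ys = hd ys # tl ys"
      using that ne by (metis list.collapse)+
    have "set (tl us) = set (tl ys)"
      using that(1,2) assms(2) u y by (metis Diff_insert_absorb distinct.simps(2) list.simps(15))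
    then have "tl us = tl ys"
      using path_of_inject_hd[of "hd ys" "tl us" "tl ys"] that assms(2) u y by metis
    then show ?thesis using u y by metis
  qed
  have "hd ys \<in> set xs"
    using ne sets by simp
  then obtain i where i: "i < length xs" "hd ys = xs ! i"
    by (metis in_set_conv_nth)
  consider "i = 0" | "Suc i = length xs" | "0 < i" "Suc i < length xs"
    using i by linarith
  then show ?thesis
  proof cases
    case 1
    then show ?thesis
      using same[of xs] assms(1) sets es i False by (simp add: hd_conv_nth)
  next
    case 2
    then have "length xs - Suc 0 = i"
      by simp
    then have "hd (rev xs) = hd ys"
      using i False by (simp add: hd_rev last_conv_nth)
    then show ?thesis
      using same[of "rev xs"] assms(1) sets es False by (simp add: edges_path_of_rev)
  next
    case 3
    have "{hd ys, xs ! (i - 1)} \<in> edges (path_of xs)"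
    proof -
      have "Suc (i - 1) < length xs \<and> {hd ys, xs ! (i - 1)} = {xs ! (i - 1), xs ! Suc (i - 1)}"
        using 3 i by (simp add: insert_commute)
      then show ?thesis unfolding path_of_def snd_conv by blast
    qed
    moreover have "{hd ys, xs ! Suc i} \<in> edges (path_of xs)"
      using 3 i unfolding path_of_def snd_conv by auto
    ultimately have "xs ! (i - 1) = xs ! Suc i"
      using path_end_neighbour_unique[OF assms(2)] es by blast
    then show ?thesis
      using assms(1) 3 by (simp add: nth_eq_iff_index_eq)
  qed
qed

text \<open>
  A hamiltonian path is traversed by exactly two vertex sequences, so uniqueness of the path as a
  graph is uniqueness of the sequence up to reversal.
\<close>

lemma uniquely_traceable_iff:
  "uniquely_traceable G \<longleftrightarrow> simple_graph G \<and>
     (\<exists>xs. xs \<noteq> [] \<and> spans (edges G) (verts G) xs \<and>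
       (\<forall>ys. spans (edges G) (verts G) ys \<longrightarrow> ys = xs \<or> ys = rev xs))" (is "?L \<longleftrightarrow> ?R")
proof
  assume L: ?L
  then obtain P where "hamiltonian_path G P"
    by (auto simp: uniquely_traceable_def)
  then obtain xs where xs: "xs \<noteq> []" "spans (edges G) (verts G) xs" "P = path_of xs"
    by (auto simp: hamiltonian_path_iff)
  have "ys = xs \<or> ys = rev xs" if ys: "spans (edges G) (verts G) ys" for ys
  proof -
    have "ys \<noteq> []"
      using ys xs by (auto simp: spans_def)
    then have "path_of xs = path_of ys"
      using L ys xs unfolding uniquely_traceable_def hamiltonian_path_iff by blast
    then show ?thesis
      using path_of_inject xs ys by (auto simp: spans_def)
  qed
  with L xs show ?R
    unfolding uniquely_traceable_def by blast
next
  assume ?R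
  then obtain xs where G: "simple_graph G" and xs: "xs \<noteq> []" "spans (edges G) (verts G) xs"
    and uniq: "\<And>ys. spans (edges G) (verts G) ys \<Longrightarrow> ys = xs \<or> ys = rev xs"
    by blast
  have "hamiltonian_path G (path_of xs)"
    using xs by (auto simp: hamiltonian_path_iff)
  moreover have "P = path_of xs" if "hamiltonian_path G P" for P
    using that uniq path_of_rev unfolding hamiltonian_path_iff by metis
  ultimately show ?L
    using G unfolding uniquely_traceable_def by blast
qed

section \<open>Labelling the vertices along the hamiltonian path\<close>

definition relabel :: "('a \<Rightarrow> 'b) \<Rightarrow> 'a set set \<Rightarrow> 'b set set" where
  "relabel f E = (\<lambda>e. f ` e) ` E"

lemma adj_relabel:
  assumes "inj_on f V" "\<forall>e\<in>E. e \<subseteq> V" "a \<in> V" "b \<in> V"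
  shows "adj (relabel f E) (f a) (f b) \<longleftrightarrow> adj E a b"
proof
  assume "adj (relabel f E) (f a) (f b)"
  then obtain e where e: "e \<in> E" "f ` {a, b} = f ` e"
    by (auto simp: adj_def relabel_def)
  then have "{a, b} = e"
    using assms inj_on_image_eq_iff[OF assms(1), of "{a, b}" e] by auto
  then show "adj E a b"
    using e by (simp add: adj_def)
next
  assume "adj E a b"
  then show "adj (relabel f E) (f a) (f b)"
    unfolding adj_def relabel_def
    using image_eqI[of "{f a, f b}" "\<lambda>e. f ` e" "{a, b}" E] by simp
qed

lemma spans_relabel:
  assumes "inj_on f V" "\<forall>e\<in>E. e \<subseteq> V" "set ys \<subseteq> V"
  shows "spans (relabel f E) (f ` V) (map f ys) \<longleftrightarrow> spans E V ys"
proof -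
  have "distinct (map f ys) \<longleftrightarrow> distinct ys"
    using assms(1,3) by (auto simp: distinct_map intro: inj_on_subset)
  moreover have "set (map f ys) = f ` V \<longleftrightarrow> set ys = V"
    using inj_on_image_eq_iff[OF assms(1,3)] by simp
  moreover have "successively (adj (relabel f E)) (map f ys) \<longleftrightarrow> successively (adj E) ys"
    unfolding successively_map
    by (rule successively_cong) (use adj_relabel[OF assms(1,2)] assms(3) in auto)
  ultimately show ?thesis
    by (simp add: spans_def)
qed

lemma relabel_simple:
  assumes "inj_on f V" "\<forall>e\<in>E. e \<subseteq> V \<and> card e = 2"
  shows "\<forall>e\<in>relabel f E. e \<subseteq> f ` V \<and> card e = 2"
proof
  fix e assume "e \<in> relabel f E"
  then obtain d where "d \<in> E" "e = f ` d"
    by (auto simp: relabel_def)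
  then show "e \<subseteq> f ` V \<and> card e = 2"
    using assms(2) card_image[OF inj_on_subset[OF assms(1)], of d] by auto
qed

lemma card_relabel:
  assumes "inj_on f V" "\<forall>e\<in>E. e \<subseteq> V"
  shows "card (relabel f E) = card E"
  unfolding relabel_def
proof (rule card_image, rule inj_onI)
  fix d e assume "d \<in> E" "e \<in> E" "f ` d = f ` e"
  then show "d = e"
    using inj_on_image_eq_iff[OF assms(1), of d e] assms(2) by blast
qed

lemma spans_relabelE:
  assumes "inj_on f V" "\<forall>e\<in>E. e \<subseteq> V" "spans (relabel f E) (f ` V) zs"
  obtains ys where "zs = map f ys" "spans E V ys"
proof -
  define ys where "ys = map (the_inv_into V f) zs"
  have zs: "set zs = f ` V"
    using assms(3) by (simp add: spans_def)
  have "map f ys = zs"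
    unfolding ys_def map_map
    by (rule map_idI) (use zs f_the_inv_into_f[OF assms(1)] in auto)
  moreover have "set ys \<subseteq> V"
    unfolding ys_def using zs the_inv_into_f_f[OF assms(1)] by auto
  ultimately show ?thesis
    using that[of ys] spans_relabel[OF assms(1,2)] assms(3) by metis
qed

text \<open>
  \<open>nat_ut n E\<close> is unique traceability in normal form: the vertices are numbered along the
  hamiltonian path. The only freedom left in the numbering is its direction.
\<close>

definition nat_ut :: "nat \<Rightarrow> nat set set \<Rightarrow> bool" where
  "nat_ut n E \<longleftrightarrow> (\<forall>e\<in>E. e \<subseteq> {..<n} \<and> card e = 2) \<and> spans E {..<n} [0..<n] \<and>
     (\<forall>ys. spans E {..<n} ys \<longrightarrow> ys = [0..<n] \<or> ys = rev [0..<n])"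

lemma nat_ut_imp_uniquely_traceable:
  assumes "nat_ut n E" "0 < n"
  shows "uniquely_traceable ({..<n}, E)"
  using assms unfolding uniquely_traceable_iff nat_ut_def simple_graph_def
  by (auto intro!: exI[of _ "[0..<n]"])

lemma uniquely_traceable_imp_nat_ut:
  assumes "uniquely_traceable G"
  obtains E where "nat_ut (graph_order G) E" "card E = graph_size G"
    "graph_iso G ({..<graph_order G}, E)"
proof -
  define n where "n = graph_order G"
  obtain xs where xs: "xs \<noteq> []" "spans (edges G) (verts G) xs"
    "\<And>ys. spans (edges G) (verts G) ys \<Longrightarrow> ys = xs \<or> ys = rev xs"
    using assms by (auto simp: uniquely_traceable_iff)
  have G: "\<forall>e\<in>edges G. e \<subseteq> verts G \<and> card e = 2"
    using assms by (auto simp: uniquely_traceable_def simple_graph_def)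
  then have GV: "\<forall>e\<in>edges G. e \<subseteq> verts G"
    by blast
  have d: "distinct xs" and V: "verts G = set xs"
    using xs(2) by (auto simp: spans_def)
  have n: "length xs = n"
    using d V by (simp add: n_def graph_order_def distinct_card)
  \<comment> \<open>The label of a vertex is its position on the hamiltonian path.\<close>
  define f where "f = the_inv_into {..<n} ((!) xs)"
  have inj: "inj_on ((!) xs) {..<n}"
    using d n by (auto intro!: inj_on_nth)
  have im: "(!) xs ` {..<n} = verts G"
    using n V by (auto simp: set_conv_nth)
  have f_nth: "f (xs ! i) = i" if "i < n" for i
    unfolding f_def using the_inv_into_f_f[OF inj] that by auto
  have finj: "inj_on f (verts G)"
    unfolding f_def using inj_on_the_inv_into[OF inj] im by simp
  have fV: "f ` verts G = {..<n}"
    using f_nth by (force simp: im[symmetric])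
  have fxs: "map f xs = [0..<n]"
    by (rule nth_equalityI) (use n f_nth in auto)
  have "nat_ut n (relabel f (edges G))"
    unfolding nat_ut_def
  proof (intro conjI allI impI)
    show "\<forall>e\<in>relabel f (edges G). e \<subseteq> {..<n} \<and> card e = 2"
      using relabel_simple[OF finj G] fV by simp
    show "spans (relabel f (edges G)) {..<n} [0..<n]"
      using spans_relabel[OF finj GV, of xs] xs(2) V fV fxs by simp
  next
    fix ys assume "spans (relabel f (edges G)) {..<n} ys"
    then obtain us where us: "ys = map f us" "spans (edges G) (verts G) us"
      using spans_relabelE[OF finj GV] fV by metis
    then have "us = xs \<or> us = rev xs"
      using xs(3) by blast
    then show "ys = [0..<n] \<or> ys = rev [0..<n]"
      using us(1) fxs by (metis rev_map)
  qed
  moreover have "card (relabel f (edges G)) = graph_size G"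
    using card_relabel[OF finj GV] by (simp add: graph_size_def)
  moreover have "graph_iso G ({..<n}, relabel f (edges G))"
    unfolding graph_iso_def using finj fV
    by (intro exI[of _ f]) (simp add: bij_betw_def relabel_def)
  ultimately show ?thesis
    using that n_def by blast
qed

section \<open>Chords that create a second hamiltonian path\<close>

lemma successively_upt:
  assumes "\<And>k. i \<le> k \<Longrightarrow> Suc k < j \<Longrightarrow> P k (Suc k)"
  shows "successively P [i..<j]"
  using assms by (auto simp: successively_conv_nth)

lemma nat_ut_path: "nat_ut n E \<Longrightarrow> Suc i < n \<Longrightarrow> adj E i (Suc i)"
  unfolding nat_ut_def spans_def
  using successively_nth[of "adj E" "[0..<n]" i] by simp

lemma nat_ut_bound: "nat_ut n E \<Longrightarrow> adj E i j \<Longrightarrow> i < n \<and> j < n \<and> i \<noteq> j"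
  unfolding nat_ut_def adj_def by fastforce

lemma nat_ut_edge_obtain:
  assumes "nat_ut n E" "e \<in> E"
  obtains i j where "e = {i, j}" "i < j" "j < n" "adj E i j"
proof -
  have "card e = 2" "e \<subseteq> {..<n}"
    using assms by (auto simp: nat_ut_def)
  then obtain a b where e: "e = {a, b}" "a \<noteq> b" "a < n" "b < n"
    by (auto simp: card_2_iff)
  show ?thesis
  proof (cases "a < b")
    case True
    then show ?thesis using that[of a b] e assms(2) by (simp add: adj_def)
  next
    case False
    then show ?thesis using that[of b a] e assms(2) by (simp add: adj_def insert_commute)
  qed
qed

lemma nat_ut_upt: "nat_ut n E \<Longrightarrow> j \<le> n \<Longrightarrow> successively (adj E) [i..<j]"
  by (rule successively_upt) (auto intro: nat_ut_path)

lemma nat_ut_rev_upt: "nat_ut n E \<Longrightarrow> j \<le> n \<Longrightarrow> successively (adj E) (rev [i..<j])"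
  unfolding successively_adj_rev by (rule nat_ut_upt)

text \<open>
  The common shape of the exchange arguments: a hamiltonian path that follows the numbering for a
  while cannot leave it, because starting at \<open>0\<close> it is not the reversed path either.
\<close>

lemma no_detour:
  assumes "nat_ut n E" "spans E {..<n} ([0..<i] @ c # zs)" "0 < i"
  shows "c = i"
proof -
  let ?ys = "[0..<i] @ c # zs"
  have "length ?ys = n"
    using assms(2) distinct_card[of ?ys] by (simp add: spans_def)
  then have n: "i < n" by simp
  have hd: "?ys ! 0 = 0"
    using assms(3) by (simp add: nth_append)
  have "?ys = [0..<n] \<or> ?ys = rev [0..<n]"
    using assms(1,2) unfolding nat_ut_def by blast
  then show ?thesis
  proof
    assume "?ys = [0..<n]"
    then have "?ys ! i = [0..<n] ! i" by (rule arg_cong)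
    then show ?thesis using n by (simp add: nth_append)
  next
    assume "?ys = rev [0..<n]"
    then have "?ys ! 0 = rev [0..<n] ! 0" by (rule arg_cong)
    then show ?thesis using n hd assms(3) by (simp add: rev_nth)
  qed
qed

text \<open>
  An edge from \<open>0\<close> to \<open>j\<close> would allow the initial segment before \<open>j\<close> to be traversed backwards.
\<close>

lemma first_neighbour:
  assumes "nat_ut n E" "adj E 0 j"
  shows "j = 1"
proof (rule ccontr)
  assume "j \<noteq> 1"
  with nat_ut_bound[OF assms] have j: "2 \<le> j" "j < n" by auto
  \<comment> \<open>This path starts at \<open>j - 1\<close>, which is neither \<open>0\<close> nor \<open>n - 1\<close>.\<close>
  let ?ys = "rev [0..<j] @ [j..<n]"
  have "spans E {..<n} ?ys"
    unfolding spans_def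
  proof (intro conjI)
    show "successively (adj E) ?ys"
      using nat_ut_upt[OF assms(1), of n j] nat_ut_rev_upt[OF assms(1), of j 0] assms(2) j
      by (simp add: successively_append_iff last_rev del: successively_rev)
  qed (use j in auto)
  then have "?ys = [0..<n] \<or> ?ys = rev [0..<n]"
    using assms(1) unfolding nat_ut_def by blast
  then have "?ys ! 0 = [0..<n] ! 0 \<or> ?ys ! 0 = rev [0..<n] ! 0"
    by metis
  then show False
    using j by (auto simp: nth_append rev_nth)
qed

text \<open>
  Two chords obtained from each other by a shift by one allow the segment between them to be
  reversed: \<open>0, \<dots>, i, j, j - 1, \<dots>, i + 1, j + 1, \<dots>\<close>. This restriction alone gives the upper
  bound on the number of edges.
\<close>

lemma no_parallel_chords:
  assumes "nat_ut n E" "adj E i j" "adj E (Suc i) (Suc j)" "i + 2 \<le> j"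
  shows False
proof -
  have j: "Suc j < n"
    using nat_ut_bound[OF assms(1,3)] by simp
  let ?ys = "[0..<Suc i] @ rev [Suc i..<Suc j] @ [Suc j..<n]"
  have "spans E {..<n} ?ys"
    unfolding spans_def
  proof (intro conjI)
    show "successively (adj E) ?ys"
      using nat_ut_upt[OF assms(1), of n "Suc j"] nat_ut_upt[OF assms(1), of "Suc i" 0]
        nat_ut_rev_upt[OF assms(1), of "Suc j" "Suc i"] assms(2-4) j
      by (simp add: successively_append_iff last_rev hd_rev del: successively_rev upt.simps)
  qed (use assms(4) j in auto)
  moreover have "rev [Suc i..<Suc j] = j # rev [Suc i..<j]"
    using assms(4) by simp
  ultimately have "spans E {..<n} ([0..<Suc i] @ j # (rev [Suc i..<j] @ [Suc j..<n]))"
    by (simp del: upt.simps)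
  from no_detour[OF assms(1) this] show False
    using assms(4) by simp
qed

text \<open>
  Here the new path is \<open>0, \<dots>, i, i + 3, \<dots>, j, i + 2, i + 1, j + 1, \<dots>\<close>. This and the next
  exchange serve to determine the graphs that attain the bound.
\<close>

lemma no_exchange_left:
  assumes "nat_ut n E" "adj E i (i + 3)" "adj E (i + 2) j" "adj E (i + 1) (j + 1)" "i + 4 \<le> j"
  shows False
proof -
  have j: "j + 1 < n"
    using nat_ut_bound[OF assms(1,4)] by simp
  have turn: "adj E j (i + 2)" "adj E (i + 2) (i + 1)"
    using assms(3,5) j nat_ut_path[OF assms(1), of "i + 1"] by (simp_all add: adj_commute)
  let ?ys = "[0..<Suc i] @ [i + 3..<Suc j] @ [i + 2, i + 1] @ [Suc j..<n]"
  have "spans E {..<n} ?ys"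
    unfolding spans_def
  proof (intro conjI)
    show "successively (adj E) ?ys"
      using nat_ut_upt[OF assms(1), of n "Suc j"] nat_ut_upt[OF assms(1), of "Suc i" 0]
        nat_ut_upt[OF assms(1), of "Suc j" "i + 3"] turn assms(2,4,5) j
      by (simp add: successively_append_iff successively_Cons del: upt.simps)
  qed (use assms(5) j in auto)
  moreover have "[i + 3..<Suc j] = (i + 3) # [i + 4..<Suc j]"
    using assms(5) upt_conv_Cons[of "i + 3" "Suc j"] by (simp add: numeral_eq_Suc)
  ultimately have "spans E {..<n} ([0..<Suc i] @ (i + 3) # ([i + 4..<Suc j] @ [i + 2, i + 1] @ [Suc j..<n]))"
    by (simp del: upt.simps)
  from no_detour[OF assms(1) this] show False
    by simp
qed

text \<open>
  The mirror image of the previous exchange, with the path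
  \<open>0, \<dots>, i, j + 2, j + 1, i + 1, \<dots>, j, j + 3, \<dots>\<close>.
\<close>

lemma no_exchange_right:
  assumes "nat_ut n E" "adj E i (j + 2)" "adj E (i + 1) (j + 1)" "adj E j (j + 3)" "i + 2 \<le> j"
  shows False
proof -
  have j: "j + 3 < n"
    using nat_ut_bound[OF assms(1,4)] by simp
  have turn: "adj E (j + 2) (j + 1)" "adj E (j + 1) (i + 1)"
    using assms(3) j nat_ut_path[OF assms(1), of "j + 1"] by (simp_all add: adj_commute)
  let ?ys = "[0..<Suc i] @ [j + 2, j + 1] @ [Suc i..<Suc j] @ [j + 3..<n]"
  have "spans E {..<n} ?ys"
    unfolding spans_def
  proof (intro conjI)
    show "successively (adj E) ?ys"
      using nat_ut_upt[OF assms(1), of n "j + 3"] nat_ut_upt[OF assms(1), of "Suc i" 0]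
        nat_ut_upt[OF assms(1), of "Suc j" "Suc i"] turn assms(2,4,5) j
      by (simp add: successively_append_iff successively_Cons del: upt.simps)
  qed (use assms(5) j in auto)
  then have "spans E {..<n} ([0..<Suc i] @ (j + 2) # ([j + 1] @ [Suc i..<Suc j] @ [j + 3..<n]))"
    by (simp del: upt.simps)
  from no_detour[OF assms(1) this] show False
    using assms(5) by simp
qed

section \<open>Reversing the numbering\<close>

definition mirror :: "nat \<Rightarrow> nat set set \<Rightarrow> nat set set" where
  "mirror n E = relabel (\<lambda>i. n - 1 - i) E"

lemma inj_on_mirror: "inj_on (\<lambda>i. n - 1 - i) {..<n::nat}"
  by (auto simp: inj_on_def)

lemma image_mirror: "(\<lambda>i. n - 1 - i) ` {..<n::nat} = {..<n}"
proof -
  have "i \<in> (\<lambda>i. n - 1 - i) ` {..<n}" if "i < n" for i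
    using that by (intro image_eqI[of _ _ "n - 1 - i"]) auto
  then show ?thesis by auto
qed

lemma nat_ut_edges_subset: "nat_ut n E \<Longrightarrow> \<forall>e\<in>E. e \<subseteq> {..<n}"
  by (auto simp: nat_ut_def)

lemma map_mirror_upt: "map (\<lambda>i. n - 1 - i) [0..<n] = rev [0..<n]"
  by (rule nth_equalityI) (auto simp: rev_nth)

lemma mirror_mirror:
  assumes "nat_ut n E"
  shows "mirror n (mirror n E) = E"
proof -
  have "(\<lambda>i. n - 1 - i) ` (\<lambda>i. n - 1 - i) ` e = e" if "e \<in> E" for e
  proof -
    have "e \<subseteq> {..<n}"
      using nat_ut_edges_subset[OF assms] that by blast
    then have "(\<lambda>i. n - 1 - (n - 1 - i)) ` e = id ` e"
      by (intro image_cong) auto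
    then show ?thesis by (simp add: image_image)
  qed
  then show ?thesis
    by (simp add: mirror_def relabel_def image_image)
qed

lemma card_mirror: "nat_ut n E \<Longrightarrow> card (mirror n E) = card E"
  unfolding mirror_def by (rule card_relabel[OF inj_on_mirror nat_ut_edges_subset])

lemma nat_ut_mirror:
  assumes "nat_ut n E"
  shows "nat_ut n (mirror n E)"
  unfolding nat_ut_def
proof (intro conjI allI impI)
  let ?f = "\<lambda>i. n - 1 - i"
  note E = nat_ut_edges_subset[OF assms]
  show "\<forall>e\<in>mirror n E. e \<subseteq> {..<n} \<and> card e = 2"
    using relabel_simple[OF inj_on_mirror, of E n] assms
    unfolding mirror_def image_mirror nat_ut_def by blast
  have "spans E {..<n} [0..<n]"
    using assms by (simp add: nat_ut_def)
  then have "spans (relabel ?f E) (?f ` {..<n}) (map ?f [0..<n])"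
    using spans_relabel[OF inj_on_mirror E, of "[0..<n]"] by (simp add: atLeast0LessThan)
  then have "spans (mirror n E) {..<n} (rev [0..<n])"
    unfolding image_mirror map_mirror_upt mirror_def .
  then show "spans (mirror n E) {..<n} [0..<n]"
    using spans_rev by blast
  fix ys assume "spans (mirror n E) {..<n} ys"
  then obtain us where us: "ys = map ?f us" "spans E {..<n} us"
    using spans_relabelE[OF inj_on_mirror E] unfolding mirror_def image_mirror by metis
  then have "us = [0..<n] \<or> us = rev [0..<n]"
    using assms unfolding nat_ut_def by blast
  then show "ys = [0..<n] \<or> ys = rev [0..<n]"
    using us(1) map_mirror_upt[of n] by (metis rev_map rev_rev_ident)
qed

lemma adj_mirror:
  assumes "nat_ut n E" "a < n" "b < n"
  shows "adj (mirror n E) a b \<longleftrightarrow> adj E (n - 1 - a) (n - 1 - b)"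
  using adj_relabel[OF inj_on_mirror nat_ut_edges_subset[OF assms(1)],
      of "n - 1 - a" "n - 1 - b"] assms(2,3)
  by (simp add: mirror_def)

lemma last_neighbour:
  assumes "nat_ut n E" "adj E i (n - 1)"
  shows "i = n - 2"
proof -
  have i: "i < n" "n - 1 < n" "i \<noteq> n - 1"
    using nat_ut_bound[OF assms] by auto
  have "adj (mirror n E) 0 (n - 1 - i)"
    using adj_mirror[OF assms(1), of 0 "n - 1 - i"] assms(2) i by (simp add: adj_commute)
  then have "n - 1 - i = 1"
    by (rule first_neighbour[OF nat_ut_mirror[OF assms(1)]])
  then show ?thesis by simp
qed

section \<open>Counting chords by length\<close>

definition left_ends :: "nat set set \<Rightarrow> nat \<Rightarrow> nat set" where
  "left_ends E d = {i. adj E i (i + d)}"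

text \<open>
  Each of the pairs \<open>{2q + 1, 2q + 2}\<close> contains at most one element of \<open>S\<close>; if the bound is
  attained, each contains exactly one.
\<close>

lemma nonconsecutive_card:
  assumes "S \<subseteq> {1..2 * m}" "\<And>i. i \<in> S \<Longrightarrow> Suc i \<notin> S"
  shows "card S \<le> m" "card S = m \<Longrightarrow> p < m \<Longrightarrow> 2 * p + 1 \<in> S \<longleftrightarrow> 2 * p + 2 \<notin> S"
proof -
  define T where "T q = S \<inter> {2 * q + 1, 2 * q + 2}" for q
  have T1: "card (T q) \<le> 1" for q
  proof -
    have "T q \<subseteq> {2 * q + 1} \<or> T q \<subseteq> {2 * q + 2}"
      using assms(2)[of "2 * q + 1"] unfolding T_def by auto
    then show ?thesis
      using card_mono[of "{2 * q + 1}" "T q"] card_mono[of "{2 * q + 2}" "T q"] by auto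
  qed
  have "S = (\<Union>q<m. T q)"
  proof
    show "S \<subseteq> (\<Union>q<m. T q)"
    proof
      fix i assume i: "i \<in> S"
      then have "(i - 1) div 2 < m" "i = 2 * ((i - 1) div 2) + 1 \<or> i = 2 * ((i - 1) div 2) + 2"
        using assms(1) by (auto simp: subset_iff)
      then show "i \<in> (\<Union>q<m. T q)"
        using i unfolding T_def by blast
    qed
  qed (auto simp: T_def)
  then have "card S = card (\<Union>q<m. T q)"
    by simp
  also have "\<dots> = (\<Sum>q<m. card (T q))"
  proof (rule card_UN_disjoint)
    show "\<forall>q\<in>{..<m}. \<forall>r\<in>{..<m}. q \<noteq> r \<longrightarrow> T q \<inter> T r = {}"
    proof (intro ballI impI)
      fix q r :: nat assume "q \<noteq> r"
      then have "{2 * q + 1, 2 * q + 2} \<inter> {2 * r + 1, 2 * r + 2} = {}"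
        by simp
      then show "T q \<inter> T r = {}"
        unfolding T_def by blast
    qed
  qed (auto simp: T_def)
  finally have sum: "card S = (\<Sum>q<m. card (T q))" .
  show "card S \<le> m"
    using sum_mono[of "{..<m}" "\<lambda>q. card (T q)" "\<lambda>q. 1"] T1 sum by simp
  show "2 * p + 1 \<in> S \<longleftrightarrow> 2 * p + 2 \<notin> S" if "card S = m" "p < m"
  proof -
    have "card (T p) = 1"
      using sum_mono_inv[of "\<lambda>q. card (T q)" "{..<m}" "\<lambda>q. 1" p] T1 sum that by simp
    then have "T p \<noteq> {}"
      by auto
    then show ?thesis
      using assms(2)[of "2 * p + 1"] by (auto simp: T_def)
  qed
qed

text \<open>
  An edge is determined by its length and its left end.
\<close>

lemma card_eq_sum_left_ends:
  assumes "nat_ut n E"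
  shows "card E = (\<Sum>d=1..<n. card (left_ends E d))"
proof -
  define P where "P = (SIGMA d:{1..<n}. left_ends E d)"
  have fin: "finite (left_ends E d)" for d
    by (rule finite_subset[of _ "{..<n}"]) (use nat_ut_bound[OF assms] in \<open>auto simp: left_ends_def\<close>)
  have "bij_betw (\<lambda>(d, i). {i, i + d}) P E"
    unfolding bij_betw_def
  proof
    show "inj_on (\<lambda>(d, i). {i, i + d}) P"
      by (auto simp: inj_on_def P_def doubleton_eq_iff)
    show "(\<lambda>(d, i). {i, i + d}) ` P = E"
    proof
      show "(\<lambda>(d, i). {i, i + d}) ` P \<subseteq> E"
        by (auto simp: P_def left_ends_def adj_def)
      show "E \<subseteq> (\<lambda>(d, i). {i, i + d}) ` P"
      proof
        fix e assume "e \<in> E"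
        then obtain i j where "e = {i, j}" "i < j" "j < n" "adj E i j"
          using nat_ut_edge_obtain[OF assms] by metis
        then show "e \<in> (\<lambda>(d, i). {i, i + d}) ` P"
          by (intro image_eqI[of _ _ "(j - i, i)"]) (auto simp: P_def left_ends_def)
      qed
    qed
  qed
  then have "card E = card P"
    by (rule bij_betw_same_card[symmetric])
  also have "\<dots> = (\<Sum>d=1..<n. card (left_ends E d))"
    unfolding P_def by (simp add: fin)
  finally show ?thesis .
qed

lemma left_ends_Suc_0:
  assumes "nat_ut n E"
  shows "left_ends E (Suc 0) = {..<n - 1}"
  using nat_ut_bound[OF assms] nat_ut_path[OF assms] by (fastforce simp: left_ends_def)

text \<open>
  As both ends of the path are pendant, chords join vertices from \<open>1\<close> to \<open>n - 2\<close>. The upper limit is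
  rounded up to an even number so that \<open>nonconsecutive_card\<close> applies.
\<close>

lemma left_ends_subset:
  assumes "nat_ut n E" "2 \<le> d"
  shows "left_ends E d \<subseteq> {1..2 * ((n - 1 - d) div 2)}"
proof
  fix i assume "i \<in> left_ends E d"
  then have a: "adj E i (i + d)"
    by (simp add: left_ends_def)
  have "i + d < n"
    using nat_ut_bound[OF assms(1) a] by simp
  moreover have "i \<noteq> 0"
    using first_neighbour[OF assms(1), of d] a assms(2) by (cases i) auto
  moreover have "i + d \<noteq> n - 1"
    using last_neighbour[OF assms(1), of i] a assms(2) by auto
  ultimately have "1 \<le> i" "i + d + 1 < n"
    by auto
  then show "i \<in> {1..2 * ((n - 1 - d) div 2)}"
    by (simp only: atLeastAtMost_iff) presburger
qed

lemma left_ends_nonconsecutive: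
  assumes "nat_ut n E" "2 \<le> d" "i \<in> left_ends E d"
  shows "Suc i \<notin> left_ends E d"
  using no_parallel_chords[OF assms(1), of i "i + d"] assms(2,3) by (auto simp: left_ends_def)

lemma sum_halves: "(\<Sum>k<m. k div 2) + m = (m + 1)\<^sup>2 div 4" for m :: nat
proof (induction m)
  case 0
  then show ?case by simp
next
  case (Suc m)
  have "(m + 2)\<^sup>2 div 4 = (m + 1)\<^sup>2 div 4 + m div 2 + 1"
  proof (cases "even m")
    case True
    then obtain r where m: "m = 2 * r" by blast
    have "(m + 2)\<^sup>2 = 4 * (r + 1)\<^sup>2" "(m + 1)\<^sup>2 = 1 + 4 * (r\<^sup>2 + r)"
      by (simp_all add: m power2_eq_square algebra_simps)
    then show ?thesis
      by (simp add: m power2_eq_square)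
  next
    case False
    then obtain r where m: "m = 2 * r + 1" by (blast elim: oddE)
    have "(m + 2)\<^sup>2 = 1 + 4 * (r\<^sup>2 + 3 * r + 2)" "(m + 1)\<^sup>2 = 4 * (r + 1)\<^sup>2"
      by (simp_all add: m power2_eq_square algebra_simps)
    then show ?thesis
      by (simp add: m power2_eq_square)
  qed
  then show ?case
    using Suc by simp
qed

lemma s_eq_sum:
  assumes "2 \<le> n"
  shows "s n = (n - 1) + (\<Sum>d=2..<n. (n - 1 - d) div 2)"
proof -
  obtain m where n: "n = m + 2"
    using assms by (metis le_add_diff_inverse2)
  have "(\<Sum>d=2..<n. (n - 1 - d) div 2) = (\<Sum>k<m. k div 2)"
    by (rule sum.reindex_bij_witness[of _ "\<lambda>k. n - 1 - k" "\<lambda>d. n - 1 - d"]) (auto simp: n)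
  then show ?thesis
    using sum_halves[of m] by (simp add: s_def n)
qed

lemma card_eq_path_plus_chords:
  assumes "nat_ut n E" "2 \<le> n"
  shows "card E = (n - 1) + (\<Sum>d=2..<n. card (left_ends E d))"
proof -
  have "{1..<n} = insert (Suc 0) {2..<n}"
    using assms(2) by auto
  then show ?thesis
    using card_eq_sum_left_ends[OF assms(1)] left_ends_Suc_0[OF assms(1)] by simp
qed

lemma card_left_ends_le:
  assumes "nat_ut n E" "2 \<le> d"
  shows "card (left_ends E d) \<le> (n - 1 - d) div 2"
  by (rule nonconsecutive_card(1)[OF left_ends_subset[OF assms] left_ends_nonconsecutive[OF assms]])

lemma nat_ut_card_le:
  assumes "nat_ut n E" "2 \<le> n"
  shows "card E \<le> s n"
  unfolding card_eq_path_plus_chords[OF assms] s_eq_sum[OF assms(2)]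
  by (intro add_left_mono sum_mono card_left_ends_le[OF assms(1)]) simp

definition extremal :: "nat \<Rightarrow> nat set set \<Rightarrow> bool" where
  "extremal n E \<longleftrightarrow> nat_ut n E \<and> card E = s n"

text \<open>
  If the bound on the number of edges is attained, it is attained for every length separately.
\<close>

lemma extremal_chord_pairs:
  assumes "extremal n E" "2 \<le> d" "2 * p + 2 + d < n"
  shows "adj E (2 * p + 1) (2 * p + 1 + d) \<longleftrightarrow> \<not> adj E (2 * p + 2) (2 * p + 2 + d)"
proof -
  have ut: "nat_ut n E"
    using assms(1) by (simp add: extremal_def)
  have n: "2 \<le> n"
    using assms(3) by simp
  have eq: "(\<Sum>d=2..<n. card (left_ends E d)) = (\<Sum>d=2..<n. (n - 1 - d) div 2)"
    using assms(1) card_eq_path_plus_chords[OF ut n] s_eq_sum[OF n] by (simp add: extremal_def)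
  have "card (left_ends E d) = (n - 1 - d) div 2"
    by (rule sum_mono_inv[OF eq]) (use assms(2,3) card_left_ends_le[OF ut] in simp_all)
  from nonconsecutive_card(2)[OF left_ends_subset[OF ut assms(2)] left_ends_nonconsecutive[OF ut assms(2)] this, of p]
  show ?thesis
    using assms(3) by (simp add: left_ends_def)
qed

section \<open>Extremal graphs have a vertex joined to all but one\<close>

lemma extremal_nat_ut: "extremal n E \<Longrightarrow> nat_ut n E"
  by (simp add: extremal_def)

lemma extremal_mirror: "extremal n E \<Longrightarrow> extremal n (mirror n E)"
  by (simp add: extremal_def nat_ut_mirror card_mirror)

text \<open>
  Otherwise the pair \<open>i, i + 1\<close> of left ends is represented by \<open>i + 1\<close>, next to \<open>i + 2\<close>. So for
  each length the odd left ends form an initial segment of the odd numbers.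
\<close>

lemma extremal_chord_down:
  assumes "extremal n E" "2 \<le> d" "odd i" "adj E (i + 2) (i + 2 + d)"
  shows "adj E i (i + d)"
proof (rule ccontr)
  obtain p where i: "i = 2 * p + 1"
    using assms(3) by (blast elim: oddE)
  note ut = extremal_nat_ut[OF assms(1)]
  have "i + 2 + d < n"
    using nat_ut_bound[OF ut assms(4)] by simp
  moreover assume "\<not> adj E i (i + d)"
  ultimately have "adj E (i + 1) (i + 1 + d)"
    using extremal_chord_pairs[OF assms(1,2), of p] i by simp
  then show False
    using no_parallel_chords[OF ut, of "i + 1" "i + 1 + d"] assms(2,4) by simp
qed

lemma extremal_chord_down_le:
  assumes "extremal n E" "2 \<le> d" "odd i" "adj E (i + 2 * t) (i + 2 * t + d)"
  shows "adj E i (i + d)"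
  using assms(4)
proof (induction t)
  case (Suc t)
  have "adj E (i + 2 * t) (i + 2 * t + d)"
    using extremal_chord_down[OF assms(1,2), of "i + 2 * t"] Suc.prems assms(3)
    by (simp add: algebra_simps)
  then show ?case by (rule Suc.IH)
qed simp

text \<open>
  For lengths \<open>d\<close> of this parity the number of available positions is odd. The right-hand member
  of the last pair is then a chord to the pendant vertex \<open>n - 1\<close>, so the last odd position is
  taken, and with it all odd positions.
\<close>

lemma extremal_forced_chord:
  assumes "extremal n E" "2 \<le> d" "odd i" "odd (n - d)" "i + d + 2 \<le> n"
  shows "adj E i (i + d)"
proof -
  note ut = extremal_nat_ut[OF assms(1)]
  have "even (n - 2 - d - i)"
    using assms(3-5) by presburger
  then obtain t where t: "n - 2 - d - i = 2 * t"
    by blast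
  obtain p where p: "i + 2 * t = 2 * p + 1"
    using assms(3) by (metis even_add even_mult_iff even_numeral oddE)
  have "2 * p + 2 + d = n - 1"
    using t p assms(5) by linarith
  then have "\<not> adj E (2 * p + 2) (2 * p + 2 + d)"
    using last_neighbour[OF ut, of "2 * p + 2"] assms(2) by auto
  then have "adj E (2 * p + 1) (2 * p + 1 + d)"
    using extremal_chord_pairs[OF assms(1,2), of p] \<open>2 * p + 2 + d = n - 1\<close> by simp
  then show ?thesis
    using extremal_chord_down_le[OF assms(1-3), of t] p by simp
qed

text \<open>
  If \<open>1\<close> is not adjacent to \<open>j\<close>, then \<open>2\<close> is adjacent to \<open>j + 1\<close>, and the right exchange excludes
  the chord from \<open>j\<close> to \<open>j + 3\<close>. Parity then makes \<open>j\<close> even and \<open>n\<close> odd. In this case the pairs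
  of chords of length three give a chord from \<open>i\<close> to \<open>i + 3\<close> for every odd \<open>i < j\<close>. Beginning
  with the chord from \<open>j - 3\<close> to \<open>j\<close>, the left exchange then yields that \<open>j\<close> is adjacent to
  \<open>j - 5\<close>, \<open>j - 7\<close> and so on down to \<open>1\<close>.
\<close>

lemma extremal_fan_step:
  assumes "extremal n E" "3 \<le> j" "j + 5 \<le> n" "odd (n - j)" "adj E 1 (j + 2)"
  shows "adj E 1 j"
proof (rule ccontr)
  assume no: "\<not> adj E 1 j"
  note ut = extremal_nat_ut[OF assms(1)]
  have "adj E 2 (j + 1)"
    using extremal_chord_pairs[OF assms(1), of "j - 1" 0] no assms(2,3) by (simp add: numeral_eq_Suc)
  then have n3: "\<not> adj E j (j + 3)"
    using no_exchange_right[OF ut, of 1 j] assms(2,5) by (auto simp: numeral_eq_Suc)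
  have "even j"
  proof (rule ccontr)
    assume "odd j"
    moreover from this have "odd (n - 3)"
      using assms(3,4) by presburger
    ultimately show False
      using extremal_forced_chord[OF assms(1), of 3 j] n3 assms(3) by simp
  qed
  then have "\<exists>q. j = 2 * q + 4"
    using assms(2) by presburger
  then obtain q where j: "j = 2 * q + 4"
    by blast
  have short: "adj E (2 * p + 1) (2 * p + 1 + 3)" if "p \<le> q + 1" for p
  proof -
    have "adj E (2 * (q + 1) + 1) (2 * (q + 1) + 1 + 3)"
      using extremal_chord_pairs[OF assms(1), of 3 "q + 1"] n3 assms(3) j by (simp add: numeral_eq_Suc)
    moreover have eq: "2 * p + 1 + 2 * (q + 1 - p) = 2 * (q + 1) + 1"
      using that by simp
    ultimately show ?thesis
      using extremal_chord_down_le[OF assms(1), of 3 "2 * p + 1" "q + 1 - p"] unfolding eq by simp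
  qed
  \<comment> \<open>For \<open>t = 0\<close> this is the chord from \<open>j - 3\<close> to \<open>j\<close>.\<close>
  have "adj E (2 * (q - t) + 1) j" for t
  proof (induction t)
    case 0
    then show ?case
      using short[of q] j by (simp add: add.commute)
  next
    case (Suc t)
    show ?case
    proof (cases "t < q")
      case False
      then show ?thesis using Suc by simp
    next
      case True
      define p where "p = q - Suc t"
      have p: "q - t = p + 1" "p < q"
        using True by (auto simp: p_def)
      show ?thesis
      proof (rule ccontr)
        assume "\<not> adj E (2 * (q - Suc t) + 1) j"
        then have "adj E (2 * p + 2) (j + 1)"
          using extremal_chord_pairs[OF assms(1), of "j - (2 * p + 1)" p] p j assms(3)
          by (simp add: p_def[symmetric] add.commute)
        moreover have "adj E (2 * p + 3) j"
          using Suc.IH p by (simp add: numeral_eq_Suc)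
        ultimately show False
          using no_exchange_left[OF ut, of "2 * p + 1" j] short[of p] p j
          by (simp add: numeral_eq_Suc)
      qed
    qed
  qed
  from this[of q] show False
    using no by simp
qed

text \<open>
  The vertices \<open>j\<close> of the parity of \<open>n\<close> are joined to \<open>1\<close> by forced chords. The others are reached
  from \<open>n - 3\<close> downwards in steps of two.
\<close>

lemma extremal_fan:
  assumes "extremal n E" "adj E 1 (n - 3)" "2 \<le> j" "j + 2 \<le> n"
  shows "adj E 1 j"
proof -
  note ut = extremal_nat_ut[OF assms(1)]
  consider "j = 2" | "3 \<le> j" "even (n - j)" | "3 \<le> j" "odd (n - j)"
    using assms(3) by linarith
  then show ?thesis
  proof cases
    case 1
    then show ?thesis
      using nat_ut_path[OF ut, of 1] assms(4) by (simp add: numeral_eq_Suc)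
  next
    case 2
    then have "odd (n - (j - 1))"
      using assms(4) by presburger
    then show ?thesis
      using extremal_forced_chord[OF assms(1), of "j - 1" 1] 2 assms(4) by simp
  next
    case 3
    have down: "adj E 1 (n - 3 - 2 * t)" if "2 * t + 6 \<le> n" for t
      using that
    proof (induction t)
      case 0
      then show ?case using assms(2) by simp
    next
      case (Suc t)
      define k where "k = n - 3 - 2 * Suc t"
      have k: "n - 3 - 2 * t = k + 2" "n = k + 2 * t + 5" "3 \<le> k"
        using Suc.prems by (auto simp: k_def)
      have "adj E 1 (k + 2)"
        using Suc k(1) by simp
      then have "adj E 1 k"
        using extremal_fan_step[OF assms(1), of k] k(2,3) by simp
      then show ?case
        by (simp add: k_def)
    qed
    have "\<exists>t. n = j + 3 + 2 * t"
      using 3 assms(4) by presburger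
    then obtain t where "n = j + 3 + 2 * t"
      by blast
    then show ?thesis
      using down[of t] 3 by simp
  qed
qed

text \<open>
  For the length \<open>n - 4\<close> there are just two candidates, the chord from \<open>1\<close> to \<open>n - 3\<close> and its mirror
  image from \<open>2\<close> to \<open>n - 2\<close>, and exactly one of them is present. The result is that vertex \<open>1\<close>, or
  symmetrically vertex \<open>n - 2\<close>, is adjacent to everything except the opposite pendant vertex.
\<close>

lemma extremal_fan_either_side:
  assumes "extremal n E" "4 \<le> n"
  shows "(\<forall>j. 2 \<le> j \<and> j + 2 \<le> n \<longrightarrow> adj E 1 j) \<or>
    (\<forall>j. 2 \<le> j \<and> j + 2 \<le> n \<longrightarrow> adj (mirror n E) 1 j)"
proof -
  note ut = extremal_nat_ut[OF assms(1)]
  have "adj E 1 2"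
    using nat_ut_path[OF ut, of 1] assms(2) by (simp add: numeral_eq_Suc)
  consider "n = 4" | "adj E 1 (n - 3)" | "6 \<le> n" "\<not> adj E 1 (n - 3)"
  proof -
    have "n = 4 \<or> n = 5 \<or> 6 \<le> n"
      using assms(2) by linarith
    moreover have "adj E 1 (n - 3)" if "n = 5"
      using that \<open>adj E 1 2\<close> by simp
    ultimately show ?thesis
      using that by blast
  qed
  then show ?thesis
  proof cases
    case 1
    then have "2 \<le> j \<and> j + 2 \<le> n \<longrightarrow> j = 2" for j
      by simp
    then show ?thesis
      using \<open>adj E 1 2\<close> by metis
  next
    case 2
    then show ?thesis
      using extremal_fan[OF assms(1)] by blast
  next
    case 3
    have "adj E 2 (n - 2)"
      using extremal_chord_pairs[OF assms(1), of "n - 4" 0] 3 by (simp add: numeral_eq_Suc Suc_diff_Suc)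
    then have "adj (mirror n E) 1 (n - 3)"
      using adj_mirror[OF ut, of 1 "n - 3"] 3 by (simp add: adj_commute numeral_eq_Suc)
    then show ?thesis
      using extremal_fan[OF extremal_mirror[OF assms(1)]] by blast
  qed
qed

section \<open>Prolonging a graph by two vertices\<close>

lemma pendant_end:
  assumes "distinct ys" "successively (adj E) ys" "v \<in> set ys" "\<And>w. adj E v w \<Longrightarrow> w = u"
  shows "v = hd ys \<or> v = last ys"
proof -
  obtain i where i: "i < length ys" "v = ys ! i"
    using assms(3) by (auto simp: in_set_conv_nth)
  then have ne: "ys \<noteq> []"
    by auto
  consider "i = 0" | "i = length ys - 1" | "0 < i" "Suc i < length ys"
    using i by linarith
  then show ?thesis
  proof cases
    case 3
    have "adj E v (ys ! Suc i)"
      using successively_nth[OF assms(2) 3(2)] i by simp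
    moreover have "adj E v (ys ! (i - 1))"
      using successively_nth[OF assms(2), of "i - 1"] 3 i by (simp add: adj_commute)
    ultimately have "ys ! Suc i = ys ! (i - 1)"
      using assms(4) by metis
    then show ?thesis
      using assms(1) 3 by (simp add: nth_eq_iff_index_eq)
  qed (use i ne in \<open>simp_all add: hd_conv_nth last_conv_nth\<close>)
qed

text \<open>
  The path is extended at its start by a pendant vertex and a vertex that is joined to all old
  vertices but the last. The old labels are shifted by two to make room for the new ones.
\<close>

definition prolong :: "nat \<Rightarrow> nat set set \<Rightarrow> nat set set" where
  "prolong m E = insert {0, 1} ((\<lambda>j. {1, j}) ` {2..m} \<union> relabel (\<lambda>i. i + 2) E)"

lemma inj_shift: "inj_on (\<lambda>i. i + 2) (A :: nat set)"
  by (simp add: inj_on_def)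

lemma image_shift: "(\<lambda>i. i + 2) ` {..<m} = {2..<m + 2 :: nat}"
  using image_add_atLeastLessThan'[of 2 0 m] by (simp add: lessThan_atLeast0 numeral_2_eq_2)

lemma map_shift: "map (\<lambda>i. i + 2) [0..<m] = [2..<m + 2]"
  using map_add_upt[of 2 m] by simp

lemma shifted_edge: "e \<in> relabel (\<lambda>i. i + 2) E \<Longrightarrow> e \<subseteq> {2::nat..}"
  by (auto simp: relabel_def)

lemma adj_prolong_0: "adj (prolong m E) 0 j \<longleftrightarrow> j = 1"
proof -
  have "{0, j} \<notin> relabel (\<lambda>i. i + 2) E"
    using shifted_edge[of "{0, j}" E] by auto
  moreover have "0 \<notin> e" if "e \<in> (\<lambda>j. {1, j}) ` {2..m}" for e
    using that by auto
  moreover have "{0, j} = {0, 1} \<longleftrightarrow> j = 1"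
    by (simp add: doubleton_eq_iff)
  ultimately show ?thesis
    unfolding adj_def prolong_def by blast
qed

lemma adj_prolong_1:
  assumes "2 \<le> j"
  shows "adj (prolong m E) 1 j \<longleftrightarrow> j \<le> m"
proof -
  have "{1, j} \<notin> relabel (\<lambda>i. i + 2) E"
    using shifted_edge[of "{1, j}" E] by auto
  moreover have "{1, j} \<noteq> {0, 1}"
    using assms by (simp add: doubleton_eq_iff)
  moreover have "{1, j} \<in> (\<lambda>j. {1, j}) ` {2..m} \<longleftrightarrow> j \<le> m"
  proof -
    have "{1, j} = {1, k} \<longleftrightarrow> j = k" for k
      by (simp add: doubleton_eq_iff) blast
    then show ?thesis
      using assms by (simp add: image_iff)
  qed
  ultimately show ?thesis
    unfolding adj_def prolong_def by blast
qed

lemma mem_prolong_shift: "(\<lambda>i. i + 2) ` e \<in> prolong m E \<longleftrightarrow> e \<in> E"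
proof -
  have "(\<lambda>i. i + 2) ` e \<noteq> {0, 1}" "(\<lambda>i. i + 2) ` e \<noteq> {1, j}" for j
    by (auto dest: equalityD2)
  moreover have "(\<lambda>i. i + 2) ` e \<in> relabel (\<lambda>i. i + 2) E \<longleftrightarrow> e \<in> E"
    unfolding relabel_def
    by (rule inj_image_mem_iff, rule injI, rule iffD1[OF inj_image_eq_iff[OF inj_shift]])
  ultimately show ?thesis
    by (auto simp: prolong_def)
qed

lemma adj_prolong_shift: "adj (prolong m E) (i + 2) (j + 2) \<longleftrightarrow> adj E i j"
  using mem_prolong_shift[of "{i, j}" m E] by (simp add: adj_def)

lemma inj_prolong: "prolong m E = prolong m F \<Longrightarrow> E = F"
  using mem_prolong_shift[of _ m E] mem_prolong_shift[of _ m F] by blast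

lemma card_prolong:
  assumes "nat_ut m E" "2 \<le> m"
  shows "card (prolong m E) = m + card E"
proof -
  have "E \<subseteq> Pow {..<m}"
    using nat_ut_edges_subset[OF assms(1)] by blast
  then have fin: "finite E"
    by (rule finite_subset) simp
  let ?A = "(\<lambda>j. {1, j}) ` {2..m}" and ?B = "relabel (\<lambda>i. i + 2) E"
  have "finite ?B"
    using fin by (simp add: relabel_def)
  have cA: "card ?A = m - 1"
    by (subst card_image) (auto simp: inj_on_def doubleton_eq_iff)
  have cB: "card ?B = card E"
    by (rule card_relabel[OF inj_shift[of UNIV]]) simp
  have "1 \<in> e" if "e \<in> ?A" for e
    using that by auto
  moreover have "1 \<notin> e" if "e \<in> ?B" for e
    using shifted_edge[OF that] by auto
  ultimately have "?A \<inter> ?B = {}"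
    by blast
  then have "card (?A \<union> ?B) = m - 1 + card E"
    using cA cB \<open>finite ?B\<close> by (simp add: card_Un_disjoint)
  moreover have "0 \<notin> e" if "e \<in> ?A \<union> ?B" for e
  proof -
    have "e \<in> ?A \<or> e \<subseteq> {2..}"
      using that shifted_edge by blast
    then show ?thesis by auto
  qed
  then have "{0, 1} \<notin> ?A \<union> ?B"
    by blast
  ultimately show ?thesis
    using assms(2) \<open>finite ?B\<close> by (simp add: prolong_def)
qed

lemma prolong_simple:
  assumes "nat_ut m E" "2 \<le> m" "e \<in> prolong m E"
  shows "e \<subseteq> {..<m + 2} \<and> card e = 2"
proof -
  consider "e = {0, 1}" | j where "e = {1, j}" "2 \<le> j" "j \<le> m" | "e \<in> relabel (\<lambda>i. i + 2) E"
    using assms(3) by (auto simp: prolong_def)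
  then show ?thesis
  proof cases
    case 3
    have "\<forall>e\<in>E. e \<subseteq> {..<m} \<and> card e = 2"
      using assms(1) by (simp add: nat_ut_def)
    from relabel_simple[OF inj_shift this] 3
    have "e \<subseteq> {2..<m + 2}" "card e = 2"
      unfolding image_shift by blast+
    then show ?thesis by auto
  qed (use assms(2) in auto)
qed

lemma upt_shift: "[0..<m + 2] = 0 # 1 # map (\<lambda>i. i + 2) [0..<m]"
  unfolding map_shift by (simp add: upt_conv_Cons numeral_2_eq_2 del: upt_Suc)

text \<open>
  The first and the last vertex of the prolonged path are pendant and hence are the ends of every
  hamiltonian path. Such a path therefore starts with \<open>0, 1\<close> and continues with a hamiltonian path
  of the old graph that ends in the last old vertex; there is only one.
\<close>

lemma nat_ut_prolong:
  assumes "nat_ut m E" "2 \<le> m"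
  shows "nat_ut (m + 2) (prolong m E)"
proof -
  let ?P = "prolong m E"
  have succ: "successively (adj ?P) (map (\<lambda>i. i + 2) us) \<longleftrightarrow> successively (adj E) us" for us
    by (simp add: successively_map adj_prolong_shift del: add_2_eq_Suc')
  have last_nbr: "w = m" if "adj ?P (m + 1) w" for w
  proof -
    consider "w = 0" | "w = 1" | i where "w = i + 2"
      by (metis One_nat_def add_2_eq_Suc' not0_implies_Suc)
    then show ?thesis
    proof cases
      case 1
      then show ?thesis
        using that adj_prolong_0[of m E "m + 1"] assms(2) by (simp add: adj_commute)
    next
      case 2
      then show ?thesis
        using that adj_prolong_1[of "m + 1" m E] assms(2) by (simp add: adj_commute)
    next
      case 3
      have "adj ?P (m - 1 + 2) (i + 2)"
        using that 3 assms(2) by (simp add: Suc_diff_Suc numeral_eq_Suc)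
      then have "adj E i (m - 1)"
        unfolding adj_prolong_shift by (simp add: adj_commute)
      then show ?thesis
        using last_neighbour[OF assms(1), of i] 3 assms(2) by simp
    qed
  qed
  \<comment> \<open>Up to reversal the path starts at the pendant vertex \<open>0\<close>.\<close>
  have main: "ys = [0..<m + 2]" if ys: "spans ?P {..<m + 2} ys" "hd ys = 0" for ys
  proof -
    have y: "distinct ys" "set ys = {..<m + 2}" "successively (adj ?P) ys"
      using ys(1) by (simp_all add: spans_def)
    have "length ys = m + 2"
      using distinct_card[OF y(1)] y(2) by simp
    then obtain b zs where yz: "ys = 0 # b # zs" "length zs = m"
      using ys(2) by (cases ys rule: remdups_adj.cases) auto
    have "b = 1"
      using y(3) yz(1) adj_prolong_0[of m E b] by simp
    have "set ys = insert 0 (insert 1 (set zs))" "0 \<notin> set zs" "1 \<notin> set zs"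
      using y(1) unfolding yz(1) \<open>b = 1\<close> by simp_all
    then have "set zs = {..<m + 2} - {0, 1}"
      using y(2) by blast
    moreover have "{..<m + 2} - {0, 1} = {2..<m + 2}"
      by (rule set_eqI, simp only: Diff_iff lessThan_iff insert_iff empty_iff atLeastLessThan_iff)
        presburger
    ultimately have zs: "set zs = (\<lambda>i. i + 2) ` {..<m}"
      unfolding image_shift by simp
    define us where "us = map (\<lambda>i. i - 2) zs"
    have "map (\<lambda>i. i + 2) us = zs"
      unfolding us_def map_map by (rule map_idI) (auto simp: zs)
    then have zu: "zs = map (\<lambda>i. i + 2) us" ..
    have "spans E {..<m} us"
      unfolding spans_def
    proof (intro conjI)
      show "distinct us"
        using y(1) unfolding yz(1) zu by (simp add: distinct_map)
      show "set us = {..<m}"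
        using zs unfolding zu set_map by (rule iffD1[OF inj_image_eq_iff[OF inj_shift]])
      show "successively (adj E) us"
        using y(3) succ[of us] unfolding yz(1) zu by (auto simp: successively_Cons)
    qed
    then have "us = [0..<m] \<or> us = rev [0..<m]"
      using assms(1) unfolding nat_ut_def by blast
    moreover have "us \<noteq> rev [0..<m]"
    proof
      assume "us = rev [0..<m]"
      then have "last ys = 2"
        using assms(2) by (simp add: yz(1) zu last_map last_rev)
      moreover have "m + 1 = hd ys \<or> m + 1 = last ys"
        by (rule pendant_end[OF y(1,3) _ last_nbr]) (simp add: y(2))
      ultimately show False
        using ys(2) assms(2) by simp
    qed
    ultimately show ?thesis
      unfolding upt_shift yz(1) zu \<open>b = 1\<close> by simp
  qed
  show ?thesis
    unfolding nat_ut_def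
  proof (intro conjI allI impI)
    show "\<forall>e\<in>?P. e \<subseteq> {..<m + 2} \<and> card e = 2"
      using prolong_simple[OF assms] by blast
    have "successively (adj ?P) [0..<m + 2]"
      using succ[of "[0..<m]"] nat_ut_upt[OF assms(1), of m 0] adj_prolong_0[of m E 1]
        adj_prolong_1[of 2 m E] assms(2)
      unfolding upt_shift by (simp add: successively_Cons hd_map numeral_2_eq_2)
    then show "spans ?P {..<m + 2} [0..<m + 2]"
      by (simp add: spans_def lessThan_atLeast0 del: upt_Suc)
  next
    fix ys assume ys: "spans ?P {..<m + 2} ys"
    have "0 = hd ys \<or> 0 = last ys"
      by (rule pendant_end[where E = ?P and u = 1])
        (use ys in \<open>auto simp: spans_def adj_prolong_0\<close>)
    then have "hd ys = 0 \<or> hd (rev ys) = 0"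
      by (auto simp: hd_rev)
    then show "ys = [0..<m + 2] \<or> ys = rev [0..<m + 2]"
      using main[of ys] main[of "rev ys"] ys spans_rev[of ?P _ ys] by (metis rev_rev_ident)
  qed
qed

text \<open>
  Conversely, a hamiltonian path of the graph without \<open>0\<close> and \<open>1\<close> has the pendant last vertex as one
  end. Its other end is adjacent to \<open>1\<close>, so the path extends to a hamiltonian path of the whole
  graph.
\<close>

lemma prolong_cover:
  assumes "nat_ut (m + 2) E" "2 \<le> m" "\<And>j. 2 \<le> j \<Longrightarrow> j \<le> m \<Longrightarrow> adj E 1 j"
  obtains F where "nat_ut m F" "E = prolong m F"
proof -
  define F where "F = {e. (\<lambda>i. i + 2) ` e \<in> E}"
  have E: "\<forall>e\<in>E. e \<subseteq> {..<m + 2} \<and> card e = 2"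
    using assms(1) by (simp add: nat_ut_def)
  have adjF: "adj F i j \<longleftrightarrow> adj E (i + 2) (j + 2)" for i j
    by (simp add: F_def adj_def)
  have succ: "successively (adj E) (map (\<lambda>i. i + 2) us) \<longleftrightarrow> successively (adj F) us" for us
    by (simp add: successively_map adjF del: add_2_eq_Suc')
  have nbr1: "j \<le> m" if "adj E 1 j" "2 \<le> j" for j
  proof (rule ccontr)
    assume "\<not> j \<le> m"
    then have "j = m + 1"
      using nat_ut_bound[OF assms(1) that(1)] by simp
    then show False
      using last_neighbour[OF assms(1), of 1] that assms(2) by simp
  qed
  have "E = prolong m F"
  proof (intro set_eqI iffI)
    fix e assume e: "e \<in> E"
    obtain i j where ij: "e = {i, j}" "i < j" "j < m + 2" "adj E i j"
      using nat_ut_edge_obtain[OF assms(1) e] by metis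
    consider "i = 0" | "i = 1" | "2 \<le> i"
      by linarith
    then show "e \<in> prolong m F"
    proof cases
      case 1
      then show ?thesis
        using first_neighbour[OF assms(1), of j] ij by (simp add: prolong_def)
    next
      case 2
      then show ?thesis
        using nbr1[of j] ij by (auto simp: prolong_def)
    next
      case 3
      then have "e = (\<lambda>i. i + 2) ` {i - 2, j - 2}"
        using ij by (simp del: add_2_eq_Suc')
      then show ?thesis
        using e mem_prolong_shift[of "{i - 2, j - 2}" m F] by (simp add: F_def)
    qed
  next
    fix e assume "e \<in> prolong m F"
    then consider "e = {0, 1}" | j where "e = {1, j}" "2 \<le> j" "j \<le> m"
      | d where "e = (\<lambda>i. i + 2) ` d" "d \<in> F"
      unfolding prolong_def relabel_def by auto
    then show "e \<in> E"
    proof cases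
      case 1
      then show ?thesis
        using nat_ut_path[OF assms(1), of 0] by (simp add: adj_def)
    next
      case 2
      then show ?thesis
        using assms(3) by (simp add: adj_def)
    qed (simp add: F_def)
  qed
  \<comment> \<open>Up to reversal the path ends in the pendant vertex \<open>m - 1\<close>.\<close>
  have main: "us = [0..<m]" if us: "spans F {..<m} us" "last us = m - 1" for us
  proof -
    let ?zs = "map (\<lambda>i. i + 2) us"
    have u: "distinct us" "set us = {..<m}" "successively (adj F) us"
      using us(1) by (simp_all add: spans_def)
    have "length us = m"
      using distinct_card[OF u(1)] u(2) by simp
    then have ne: "us \<noteq> []"
      using assms(2) by auto
    then have "hd us = us ! 0" "last us = us ! (m - 1)"
      using \<open>length us = m\<close> by (simp_all add: hd_conv_nth last_conv_nth)
    then have "hd us \<noteq> last us"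
      using u(1) assms(2) \<open>length us = m\<close> by (simp add: nth_eq_iff_index_eq)
    then have "hd us \<noteq> m - 1"
      using us(2) by simp
    moreover have "hd us < m"
      using ne u(2) hd_in_set[OF ne] by simp
    ultimately have "adj E 1 (hd us + 2)"
      using assms(3) by simp
    moreover have "adj E 0 1"
      using nat_ut_path[OF assms(1), of 0] by simp
    ultimately have "successively (adj E) (0 # 1 # ?zs)"
      using succ[of us] u(3) ne by (simp add: successively_Cons hd_map)
    moreover have "set (0 # 1 # ?zs) = set [0..<m + 2]"
      unfolding upt_shift using u(2) by (simp add: lessThan_atLeast0)
    then have "set (0 # 1 # ?zs) = {..<m + 2}"
      by (simp only: set_upt lessThan_atLeast0)
    moreover have "distinct (0 # 1 # ?zs)"
      using u(1) by (auto simp: distinct_map inj_on_def)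
    ultimately have "spans E {..<m + 2} (0 # 1 # ?zs)"
      unfolding spans_def by blast
    then have "0 # 1 # ?zs = [0..<m + 2] \<or> 0 # 1 # ?zs = rev [0..<m + 2]"
      using assms(1) unfolding nat_ut_def by blast
    moreover have "0 # 1 # ?zs \<noteq> rev [0..<m + 2]"
      by simp
    ultimately have "?zs = map (\<lambda>i. i + 2) [0..<m]"
      unfolding upt_shift by simp
    then show ?thesis
      by (rule map_injective) (rule inj_shift)
  qed
  have "nat_ut m F"
    unfolding nat_ut_def
  proof (intro conjI allI impI)
    show "\<forall>e\<in>F. e \<subseteq> {..<m} \<and> card e = 2"
    proof
      fix e assume "e \<in> F"
      then have "(\<lambda>i. i + 2) ` e \<subseteq> {..<m + 2} \<and> card ((\<lambda>i. i + 2) ` e) = 2"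
        using E by (simp add: F_def)
      then show "e \<subseteq> {..<m} \<and> card e = 2"
        using card_image[OF inj_shift, of e] by auto
    qed
    have "successively (adj E) (map (\<lambda>i. i + 2) [0..<m])"
      unfolding map_shift by (rule nat_ut_upt[OF assms(1)]) simp
    then show "spans F {..<m} [0..<m]"
      using succ[of "[0..<m]"] by (simp add: spans_def lessThan_atLeast0)
  next
    fix us assume us: "spans F {..<m} us"
    have nbr: "w = m - 2" if "adj F (m - 1) w" for w
    proof -
      have "m - 1 + 2 = m + 1"
        using assms(2) by simp
      then have "adj E (w + 2) (m + 1)"
        using that adjF[of "m - 1" w] by (simp add: adj_commute)
      then show ?thesis
        using last_neighbour[OF assms(1), of "w + 2"] by simp
    qed
    have "m - 1 = hd us \<or> m - 1 = last us"
      by (rule pendant_end[OF _ _ _ nbr]) (use us assms(2) in \<open>auto simp: spans_def\<close>)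
    then have "last us = m - 1 \<or> last (rev us) = m - 1"
      by (auto simp: last_rev)
    then show "us = [0..<m] \<or> us = rev [0..<m]"
      using main[of us] main[of "rev us"] us spans_rev[of F _ us] by (metis rev_rev_ident)
  qed
  with \<open>E = prolong m F\<close> show ?thesis
    using that by blast
qed

section \<open>Generating and counting the extremal graphs\<close>

lemma s_Suc_Suc: "1 \<le> m \<Longrightarrow> s (m + 2) = m + s m"
proof -
  assume "1 \<le> m"
  then obtain k where "m = k + 1"
    by (metis add.commute le_iff_add)
  moreover have "(k + 2)\<^sup>2 = k\<^sup>2 + (k + 1) * 4"
    by (simp add: power2_eq_square algebra_simps)
  ultimately show ?thesis
    by (simp add: s_def)
qed

definition extremal_set :: "nat \<Rightarrow> nat set set set" where
  "extremal_set n = {E. extremal n E}"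

lemma finite_extremal_set: "finite (extremal_set n)"
proof (rule finite_subset)
  show "extremal_set n \<subseteq> Pow (Pow {..<n})"
    using nat_ut_edges_subset extremal_nat_ut unfolding extremal_set_def by blast
qed simp

lemma extremal_prolong: "extremal m E \<Longrightarrow> 2 \<le> m \<Longrightarrow> extremal (m + 2) (prolong m E)"
  by (simp add: extremal_def nat_ut_prolong card_prolong s_Suc_Suc del: add_2_eq_Suc')

lemma extremal_prolong_cover:
  assumes "extremal (m + 2) E" "2 \<le> m" "\<And>j. 2 \<le> j \<Longrightarrow> j \<le> m \<Longrightarrow> adj E 1 j"
  shows "E \<in> prolong m ` extremal_set m"
proof -
  have ut: "nat_ut (m + 2) E" and c: "card E = s (m + 2)"
    using assms(1) by (simp_all add: extremal_def)
  obtain F where F: "nat_ut m F" "E = prolong m F"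
    using prolong_cover[OF ut assms(2,3)] by blast
  have "card F = s m"
    using card_prolong[OF F(1) assms(2)] c F(2) assms(2) s_Suc_Suc[of m] by simp
  then show ?thesis
    using F by (simp add: extremal_set_def extremal_def)
qed

lemma extremal_set_step:
  assumes "2 \<le> m"
  shows "extremal_set (m + 2) =
    prolong m ` extremal_set m \<union> mirror (m + 2) ` prolong m ` extremal_set m" (is "?L = ?R")
proof
  show "?L \<subseteq> ?R"
  proof
    fix E assume "E \<in> ?L"
    then have E: "extremal (m + 2) E"
      by (simp add: extremal_set_def)
    have "4 \<le> m + 2"
      using assms by simp
    from extremal_fan_either_side[OF E this]
    show "E \<in> ?R"
    proof
      assume "\<forall>j. 2 \<le> j \<and> j + 2 \<le> m + 2 \<longrightarrow> adj E 1 j"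
      then have "E \<in> prolong m ` extremal_set m"
        by (intro extremal_prolong_cover[OF E assms]) auto
      then show ?thesis ..
    next
      assume "\<forall>j. 2 \<le> j \<and> j + 2 \<le> m + 2 \<longrightarrow> adj (mirror (m + 2) E) 1 j"
      then have "mirror (m + 2) E \<in> prolong m ` extremal_set m"
        by (intro extremal_prolong_cover[OF extremal_mirror[OF E] assms]) auto
      then have "mirror (m + 2) (mirror (m + 2) E) \<in> mirror (m + 2) ` prolong m ` extremal_set m"
        by (rule imageI)
      then show ?thesis
        unfolding mirror_mirror[OF extremal_nat_ut[OF E]] ..
    qed
  qed
  show "?R \<subseteq> ?L"
    using extremal_prolong[OF _ assms] extremal_mirror[of "m + 2"]
    by (auto simp: extremal_set_def simp del: add_2_eq_Suc')
qed

text \<open>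
  On five vertices the chord to \<open>n - 3\<close> required by \<open>extremal_fan\<close> is a path edge at both ends.
  So both prolongations coincide, and the number of graphs does not double yet.
\<close>

lemma extremal_set_5: "extremal_set (3 + 2) = prolong 3 ` extremal_set 3"
proof
  show "extremal_set (3 + 2) \<subseteq> prolong 3 ` extremal_set 3"
  proof
    fix E assume "E \<in> extremal_set (3 + 2)"
    then have E: "extremal (3 + 2) E"
      by (simp add: extremal_set_def)
    have "adj E 1 (3 + 2 - 3)"
      using nat_ut_path[OF extremal_nat_ut[OF E], of 1] by (simp add: numeral_eq_Suc)
    then have "adj E 1 j" if "2 \<le> j" "j \<le> 3" for j
      by (rule extremal_fan[OF E]) (use that in simp_all)
    then show "E \<in> prolong 3 ` extremal_set 3"
      by (rule extremal_prolong_cover[OF E, rotated]) simp_all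
  qed
qed (use extremal_set_step[of 3] in simp)

text \<open>
  In the first graph \<open>1\<close> and \<open>m - 1\<close> are adjacent. In the second one this would mean that \<open>0\<close> and
  \<open>m - 2\<close> are adjacent in \<open>F\<close>, where \<open>0\<close> is pendant. For \<open>m = 3\<close> there is no
  contradiction, since \<open>m - 2\<close> is the neighbour of \<open>0\<close>.
\<close>

lemma prolong_mirror_disjoint:
  assumes "4 \<le> m" "nat_ut m E" "nat_ut m F"
  shows "prolong m E \<noteq> mirror (m + 2) (prolong m F)"
proof
  assume eq: "prolong m E = mirror (m + 2) (prolong m F)"
  have "adj (prolong m E) 1 (m - 1)"
    using assms(1) by (subst adj_prolong_1) auto
  then have "adj (prolong m F) m 2"
    using adj_mirror[OF nat_ut_prolong[OF assms(3)], of 1 "m - 1"] assms(1) eq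
    by (simp add: numeral_2_eq_2)
  then have "adj (prolong m F) (m - 2 + 2) (0 + 2)"
    using assms(1) by (simp del: add_2_eq_Suc')
  then have "adj F 0 (m - 2)"
    unfolding adj_prolong_shift by (simp add: adj_commute)
  then show False
    using first_neighbour[OF assms(3)] assms(1) by fastforce
qed

lemma path_edges_finite_card:
  "distinct xs \<Longrightarrow> finite (edges (path_of xs)) \<and> card (edges (path_of xs)) = length xs - 1"
proof (induction xs rule: induct_list012)
  case (3 x y zs)
  have "{x, y} \<notin> edges (path_of (y # zs))"
    using edges_path_of_subset[of "{x, y}" "y # zs"] "3.prems" by auto
  then show ?case
    using "3.IH"(2) "3.prems" by (simp add: edges_path_of)
qed (simp_all add: edges_path_of)

lemma nat_ut_path_edges: "nat_ut n E \<Longrightarrow> edges (path_of [0..<n]) \<subseteq> E"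
  unfolding successively_adj_iff[symmetric] by (erule nat_ut_upt, rule order_refl)

lemma nat_ut_subset:
  assumes "nat_ut n E" "F \<subseteq> E" "edges (path_of [0..<n]) \<subseteq> F"
  shows "nat_ut n F"
proof -
  have "spans E {..<n} ys" if "spans F {..<n} ys" for ys
    using that assms(2) unfolding spans_def successively_adj_iff by (auto dest: order_trans)
  moreover have "spans F {..<n} [0..<n]"
    using assms(3) by (simp add: spans_def successively_adj_iff lessThan_atLeast0)
  moreover have "\<forall>e\<in>F. e \<subseteq> {..<n} \<and> card e = 2"
    using assms(1,2) unfolding nat_ut_def by blast
  ultimately show ?thesis
    using assms(1) unfolding nat_ut_def by blast
qed

lemma nat_ut_path_of: "nat_ut n (edges (path_of [0..<n]))" (is "nat_ut n ?P")
  unfolding nat_ut_def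
proof (intro conjI allI impI)
  show "\<forall>e\<in>?P. e \<subseteq> {..<n} \<and> card e = 2"
    by (auto simp: path_of_def)
  show "spans ?P {..<n} [0..<n]"
    by (simp add: spans_def successively_adj_iff lessThan_atLeast0)
  fix ys assume ys: "spans ?P {..<n} ys"
  then have d: "distinct ys" and S: "set ys = {..<n}" and sub: "edges (path_of ys) \<subseteq> ?P"
    by (simp_all add: spans_def successively_adj_iff)
  have "length ys = n"
    using distinct_card[OF d] S by simp
  then have "edges (path_of ys) = ?P"
    using card_subset_eq[OF _ sub] path_edges_finite_card[OF d] path_edges_finite_card[of "[0..<n]"]
    by simp
  then have "path_of [0..<n] = path_of ys"
    using S by (simp add: path_of_def lessThan_atLeast0)
  then show "ys = [0..<n] \<or> ys = rev [0..<n]"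
    using path_of_inject[OF _ d] by simp
qed

lemma extremal_set_path:
  assumes "s n = n - 1"
  shows "extremal_set n = {edges (path_of [0..<n])}"
proof -
  have P: "card (edges (path_of [0..<n])) = n - 1"
    using path_edges_finite_card[of "[0..<n]"] by simp
  have "E = edges (path_of [0..<n])" if "extremal n E" for E
  proof -
    have "E \<subseteq> Pow {..<n}"
      using nat_ut_edges_subset[OF extremal_nat_ut[OF that]] by blast
    then have "finite E"
      by (rule finite_subset) simp
    then show ?thesis
      using card_subset_eq[OF _ nat_ut_path_edges[OF extremal_nat_ut[OF that]]] P that assms
      by (simp add: extremal_def)
  qed
  moreover have "extremal n (edges (path_of [0..<n]))"
    using nat_ut_path_of P assms by (simp add: extremal_def)
  ultimately show ?thesis
    unfolding extremal_set_def by blast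
qed

lemma card_image_prolong: "card (prolong m ` A) = card A"
  by (rule card_image, rule inj_onI) (rule inj_prolong)

text \<open>
  From \<open>m \<ge> 4\<close> on, the prolongations of an extremal graph at the two ends are different, so every
  second order doubles the number of labelled extremal graphs.
\<close>

lemma card_extremal_set: "2 \<le> n \<Longrightarrow> card (extremal_set n) = 2 ^ (n div 2 - 2)"
proof (induction n rule: less_induct)
  case (less n)
  consider "n = 2" | "n = 3" | "n = 4" | "n = 3 + 2" | m where "n = m + 2" "4 \<le> m"
  proof -
    have "n = 2 \<or> n = 3 \<or> n = 4 \<or> n = 3 + 2 \<or> (\<exists>m. n = m + 2 \<and> 4 \<le> m)"
      using less.prems by presburger
    then show ?thesis
      using that by blast
  qed
  then show ?case
  proof cases
    case 1
    then show ?thesis using extremal_set_path[of 2] by (simp add: s_def)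
  next
    case 2
    then show ?thesis using extremal_set_path[of 3] by (simp add: s_def)
  next
    case 3
    then show ?thesis using extremal_set_path[of 4] by (simp add: s_def)
  next
    case 4
    then show ?thesis
      using extremal_set_path[of 3] unfolding 4 extremal_set_5 by (simp add: s_def)
  next
    case 5
    let ?A = "prolong m ` extremal_set m"
    have "finite ?A"
      using finite_extremal_set by blast
    have mm: "mirror n (mirror n E) = E" if "E \<in> ?A" for E
    proof -
      have "E \<in> extremal_set n"
        using that extremal_set_step[of m] 5 by simp
      then show ?thesis
        by (intro mirror_mirror extremal_nat_ut) (simp add: extremal_set_def)
    qed
    have "card (mirror n ` ?A) = card ?A"
      by (rule card_image, rule inj_on_inverseI) (rule mm)
    moreover have "?A \<inter> mirror n ` ?A = {}"
      using prolong_mirror_disjoint[OF 5(2)] 5(1) by (auto simp: extremal_set_def extremal_def)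
    ultimately have "card (extremal_set n) = 2 * card (extremal_set m)"
      using extremal_set_step[of m] 5 \<open>finite ?A\<close>
      by (simp add: card_Un_disjoint card_image_prolong)
    also have "card (extremal_set m) = 2 ^ (m div 2 - 2)"
      using less.IH[of m] 5 by simp
    also have "2 * 2 ^ (m div 2 - 2) = (2 :: nat) ^ (n div 2 - 2)"
    proof -
      have "n div 2 - 2 = Suc (m div 2 - 2)"
        using 5 by linarith
      then show ?thesis by simp
    qed
    finally show ?thesis .
  qed
qed

section \<open>Isomorphism classes\<close>

text \<open>
  An isomorphism preserves the hamiltonian path, hence it preserves or reverses the numbering.
\<close>

lemma graph_iso_nat_ut:
  assumes "nat_ut n E" "nat_ut n F" "graph_iso ({..<n}, E) ({..<n}, F)"
  shows "F = E \<or> F = mirror n E"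
proof -
  obtain f where f: "bij_betw f {..<n} {..<n}" and F: "F = relabel f E"
    using assms(3) by (auto simp: graph_iso_def relabel_def)
  have inj: "inj_on f {..<n}" and im: "f ` {..<n} = {..<n}"
    using f by (auto simp: bij_betw_def)
  note E = nat_ut_edges_subset[OF assms(1)]
  have "spans E {..<n} [0..<n]"
    using assms(1) by (simp add: nat_ut_def)
  then have "spans F {..<n} (map f [0..<n])"
    using spans_relabel[OF inj E, of "[0..<n]"] im F by (simp add: lessThan_atLeast0)
  then have "map f [0..<n] = [0..<n] \<or> map f [0..<n] = rev [0..<n]"
    using assms(2) unfolding nat_ut_def by blast
  moreover have cong: "relabel f E = relabel g E" if "map f [0..<n] = map g [0..<n]" for g
  proof -
    have "f ` e = g ` e" if "e \<in> E" for e
      using E that \<open>map f [0..<n] = map g [0..<n]\<close> by (intro image_cong) (auto simp: subset_iff)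
    then show ?thesis
      unfolding relabel_def by (rule image_cong[OF refl])
  qed
  ultimately show ?thesis
  proof (elim disjE)
    assume "map f [0..<n] = [0..<n]"
    then have "relabel f E = relabel (\<lambda>i. i) E"
      by (intro cong) simp
    then show ?thesis
      by (simp add: F relabel_def)
  next
    assume "map f [0..<n] = rev [0..<n]"
    then show ?thesis
      using cong[of "\<lambda>i. n - 1 - i"] unfolding map_mirror_upt F mirror_def by blast
  qed
qed

lemma graph_iso_mirror: "graph_iso ({..<n}, E) ({..<n}, mirror n E)"
  unfolding graph_iso_def mirror_def relabel_def
  using inj_on_mirror[of n] image_mirror[of n]
  by (intro exI[of _ "\<lambda>i. n - 1 - i"]) (simp add: bij_betw_def)

lemma graph_iso_trans:
  assumes "graph_iso G H" "graph_iso H K"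
  shows "graph_iso G K"
proof -
  obtain f where f: "bij_betw f (verts G) (verts H)" "(\<lambda>e. f ` e) ` edges G = edges H"
    using assms(1) unfolding graph_iso_def by blast
  obtain g where g: "bij_betw g (verts H) (verts K)" "(\<lambda>e. g ` e) ` edges H = edges K"
    using assms(2) unfolding graph_iso_def by blast
  have "(\<lambda>e. (g \<circ> f) ` e) ` edges G = edges K"
    unfolding g(2)[symmetric] f(2)[symmetric] by (simp add: image_image)
  then show ?thesis
    using bij_betw_trans[OF f(1) g(1)] unfolding graph_iso_def by blast
qed

text \<open>
  The graphs prolonged at the start represent all isomorphism classes, since the others are
  their mirror images. For order \<open>2\<close> and \<open>3\<close>, where there is nothing to prolong from, the path is the
  only extremal graph.
\<close>

definition extremal_reps :: "nat \<Rightarrow> nat set set set" where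
  "extremal_reps n = (if n < 4 then extremal_set n else prolong (n - 2) ` extremal_set (n - 2))"

lemma extremal_set_reps:
  assumes "2 \<le> n"
  shows "extremal_set n = extremal_reps n \<union> mirror n ` extremal_reps n"
proof (cases "n < 4")
  case True
  then show ?thesis
    using extremal_mirror[of n] by (auto simp: extremal_reps_def extremal_set_def)
next
  case False
  then obtain m where "n = m + 2" "2 \<le> m"
    using that[of "n - 2"] by simp
  then show ?thesis
    using extremal_set_step[of m] by (simp add: extremal_reps_def)
qed

lemma card_extremal_reps:
  assumes "2 \<le> n"
  shows "card (extremal_reps n) = 2 ^ (n div 2 - 3)"
proof (cases "n < 4")
  case True
  then have "n div 2 - 2 = 0" "n div 2 - 3 = 0"
    by linarith+
  then show ?thesis
    using card_extremal_set[OF assms] True by (simp add: extremal_reps_def)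
next
  case False
  then have "(n - 2) div 2 - 2 = n div 2 - 3"
    by linarith
  then show ?thesis
    using card_extremal_set[of "n - 2"] False by (simp add: extremal_reps_def card_image_prolong)
qed

lemma extremal_reps_not_iso:
  assumes "2 \<le> n" "E \<in> extremal_reps n" "F \<in> extremal_reps n"
    "graph_iso ({..<n}, E) ({..<n}, F)"
  shows "E = F"
proof (cases "n < 6")
  case True
  then have "n div 2 - 3 = 0"
    by linarith
  then have "card (extremal_reps n) = 1"
    using card_extremal_reps[OF assms(1)] by simp
  then show ?thesis
    using assms(2,3) by (auto simp: card_1_singleton_iff)
next
  case False
  have "extremal n E" "extremal n F"
    using assms(2,3) extremal_set_reps[OF assms(1)] by (auto simp: extremal_set_def)
  then have "F = E \<or> F = mirror n E"
    using graph_iso_nat_ut[OF _ _ assms(4)] by (simp add: extremal_nat_ut)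
  moreover have "F \<noteq> mirror n E"
  proof -
    define m where "m = n - 2"
    have m: "n = m + 2" "4 \<le> m"
      using False by (simp_all add: m_def)
    obtain E' F' where "E = prolong m E'" "F = prolong m F'" "extremal m E'" "extremal m F'"
      using assms(2,3) False by (auto simp: extremal_reps_def extremal_set_def m_def)
    then show ?thesis
      using prolong_mirror_disjoint[OF m(2)] unfolding m(1) by (simp add: extremal_nat_ut)
  qed
  ultimately show ?thesis by simp
qed

lemma pow_div_eq_max_powi_ceiling:
  assumes "2 \<le> n"
  shows "real (2 ^ (n div 2 - 3)) = max 1 (2 powi (\<lceil>(real n - 1) / 2\<rceil> - 3))"
proof -
  have "\<lceil>(real n - 1) / 2\<rceil> = int (n div 2)"
  proof (rule ceiling_unique)
    show "real_of_int (int (n div 2)) - 1 < (real n - 1) / 2"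
      by (cases "even n") (auto elim!: evenE oddE)
    show "(real n - 1) / 2 \<le> real_of_int (int (n div 2))"
      by (cases "even n") (auto elim!: evenE oddE)
  qed
  then have ceil: "\<lceil>(real n - 1) / 2\<rceil> - 3 = int (n div 2) - 3"
    by simp
  show ?thesis
  proof (cases "3 \<le> n div 2")
    case True
    then have eq: "int (n div 2) - 3 = int (n div 2 - 3)"
      by simp
    show ?thesis
      unfolding ceil eq power_int_of_nat
      using one_le_power[of "2 :: real" "n div 2 - 3"] by (simp add: max_def)
  next
    case False
    then have "2 powi (int (n div 2) - 3) \<le> (1 :: real)"
      by (simp add: power_int_def power_le_one)
    then show ?thesis
      unfolding ceil using False by simp
  qed
qed

text \<open>
  Every edge outside the hamiltonian path can be deleted without losing unique traceability, so
  all sizes below the maximum are realised by subgraphs of an extremal graph.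
\<close>

theorem theorem3p18:
  fixes n :: nat
  assumes "n \<ge> 2"
  shows "(\<forall>G :: 'a ugraph. uniquely_traceable G \<and> graph_order G = n \<longrightarrow> graph_size G \<le> s n)
    \<and> (\<forall>m. n - 1 \<le> m \<and> m \<le> s n \<longrightarrow>
         (\<exists>G :: nat ugraph. uniquely_traceable G \<and> graph_order G = n \<and> graph_size G = m))
    \<and> (\<exists>R :: nat ugraph set.
         finite R
         \<and> real (card R) = max 1 (2 powi (\<lceil>(real n - 1) / 2\<rceil> - 3))
         \<and> (\<forall>H\<in>R. uniquely_traceable H \<and> graph_order H = n \<and> graph_size H = s n)
         \<and> (\<forall>H\<in>R. \<forall>H'\<in>R. graph_iso H H' \<longrightarrow> H = H')
         \<and> (\<forall>G :: 'a ugraph. uniquely_traceable G \<and> graph_order G = n \<and> graph_size G = s n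
              \<longrightarrow> (\<exists>H\<in>R. graph_iso G H)))"
proof (intro conjI allI impI)
  fix G :: "'a ugraph" assume "uniquely_traceable G \<and> graph_order G = n"
  then obtain E where "nat_ut n E" "card E = graph_size G"
    by (metis uniquely_traceable_imp_nat_ut)
  then show "graph_size G \<le> s n"
    using nat_ut_card_le[OF _ assms] by metis
next
  fix m assume m: "n - 1 \<le> m \<and> m \<le> s n"
  let ?P = "edges (path_of [0..<n])"
  have "extremal_set n \<noteq> {}"
    using card_extremal_set[OF assms] by auto
  then obtain E where E: "nat_ut n E" "card E = s n"
    by (auto simp: extremal_set_def extremal_def)
  have "finite E"
    using E(2) by (metis card.infinite s_def add_is_0 one_neq_zero)
  moreover have "card ?P = n - 1"
    using path_edges_finite_card[of "[0..<n]"] by simp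
  ultimately obtain F where F: "?P \<subseteq> F" "F \<subseteq> E" "card F = m"
    using exists_subset_between[of ?P m E] nat_ut_path_edges[OF E(1)] E(2) m by auto
  have "uniquely_traceable ({..<n}, F)"
    using nat_ut_imp_uniquely_traceable nat_ut_subset[OF E(1) F(2,1)] assms by simp
  then show "\<exists>G :: nat ugraph. uniquely_traceable G \<and> graph_order G = n \<and> graph_size G = m"
    using F(3) by (intro exI[of _ "({..<n}, F)"]) (simp add: graph_order_def graph_size_def)
next
  let ?R = "Pair {..<n} ` extremal_reps n"
  have R: "extremal n E" if "E \<in> extremal_reps n" for E
    using that extremal_set_reps[OF assms] by (auto simp: extremal_set_def)
  have fin: "finite (extremal_reps n)"
    using finite_extremal_set[of n] extremal_set_reps[OF assms] by simp
  have "card ?R = 2 ^ (n div 2 - 3)"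
    using card_extremal_reps[OF assms] by (simp add: card_image inj_on_def)
  then have "real (card ?R) = max 1 (2 powi (\<lceil>(real n - 1) / 2\<rceil> - 3))"
    using pow_div_eq_max_powi_ceiling[OF assms] by simp
  moreover have "\<forall>H\<in>?R. uniquely_traceable H \<and> graph_order H = n \<and> graph_size H = s n"
    using R nat_ut_imp_uniquely_traceable assms
    by (auto simp: graph_order_def graph_size_def extremal_def)
  moreover have "\<forall>H\<in>?R. \<forall>H'\<in>?R. graph_iso H H' \<longrightarrow> H = H'"
    using extremal_reps_not_iso[OF assms] by auto
  moreover have "\<exists>H\<in>?R. graph_iso G H"
    if G: "uniquely_traceable G \<and> graph_order G = n \<and> graph_size G = s n" for G :: "'a ugraph"
  proof -
    obtain E where E: "nat_ut n E" "card E = s n" "graph_iso G ({..<n}, E)"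
      using G by (metis uniquely_traceable_imp_nat_ut)
    then have "E \<in> extremal_reps n \<union> mirror n ` extremal_reps n"
      unfolding extremal_set_reps[OF assms, symmetric] by (simp add: extremal_set_def extremal_def)
    then show ?thesis
    proof
      assume "E \<in> extremal_reps n"
      then show ?thesis using E(3) by blast
    next
      assume "E \<in> mirror n ` extremal_reps n"
      then obtain F where F: "F \<in> extremal_reps n" "E = mirror n F"
        by blast
      then have "mirror n E = F"
        using mirror_mirror[OF extremal_nat_ut[OF R[OF F(1)]]] by simp
      then have "graph_iso G ({..<n}, F)"
        using graph_iso_trans[OF E(3) graph_iso_mirror] by metis
      then show ?thesis using F(1) by blast
    qed
  qed
  ultimately show "\<exists>R :: nat ugraph set.
         finite R
         \<and> real (card R) = max 1 (2 powi (\<lceil>(real n - 1) / 2\<rceil> - 3))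
         \<and> (\<forall>H\<in>R. uniquely_traceable H \<and> graph_order H = n \<and> graph_size H = s n)
         \<and> (\<forall>H\<in>R. \<forall>H'\<in>R. graph_iso H H' \<longrightarrow> H = H')
         \<and> (\<forall>G :: 'a ugraph. uniquely_traceable G \<and> graph_order G = n \<and> graph_size G = s n
              \<longrightarrow> (\<exists>H\<in>R. graph_iso G H))"
    using fin by (intro exI[of _ ?R]) simp
qed

end
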